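(* Let $X$ be a random variable with mean $\mu$ and variance $\sigma^2\in(0,\infty)$, and suppose that $\mathbb E|X-\mu|^{1+\delta}<\infty$ for some $1\le\delta\le2$. Let $\{k_j\}_{j\ge1}\subset\mathbb N$ and $\{n_j\}_{j\ge1}\subset\mathbb N$ be two non-decreasing, unbounded sequences satisfying $\sqrt{N_j}\,\phi(\delta,n_j)=o(1)$ as $j\to\infty$, where $N_j:=k_jn_j$ and $$\phi(\delta,n)=n^{-\delta/2}\cdot\left(n^{-\frac{2-\delta}{4}}\vee g^{\frac{2-\delta}{2+\delta}}(n^{1/4})\right),\qquad g(u)=\mathbb E\left(|X-\mu|^{1+\delta}\mathbf 1_{\{|X-\mu|\ge u\}}\right).$$ Let $\widehat\mu_{N_j,p}$ be computed from $N_j$ i.i.d. copies of $X$ (no outliers) using $k_j$ blocks of size $n_j$. Then for any $p\ge1$, $$\sqrt{N_j}\left(\widehat\mu_{N_j,p}-\mu\right)\xrightarrow{d}\mathcal N(0,\sigma^2)\quad\text{as } j\to\infty.$$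
   Context: For $N=kn$ observations $X_1,\dots,X_N$, the set $\{1,\dots,N\}$ is partitioned into $k$ disjoint blocks $G_1,\dots,G_k$, each of cardinality $n$ (the partition does not depend on the data values). For each block $i$, $\bar\mu_i=\frac1n\sum_{l\in G_i}X_l$ and $\widehat\sigma_i=\sqrt{\frac1n\sum_{l\in G_i}(X_l-\bar\mu_i)^2}$. The estimator is $$\widehat\mu_{N,p}=\sum_{i=1}^k\alpha_i\bar\mu_i,\qquad\alpha_i=\frac{1/\widehat\sigma_i^p}{\sum_{l=1}^k1/\widehat\sigma_l^p}$$ (defined when all $\widehat\sigma_i>0$; it may be given an arbitrary value otherwise). The notation $a\vee b$ means $\max(a,b)$, $g^{\beta}(u)=(g(u))^{\beta}$ with $0^0=1$, and $\xrightarrow{d}$ denotes convergence in distribution. *)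

theory Defs
  imports "HOL-Probability.Probability" "HOL-Library.Landau_Symbols"
begin

definition block_partition :: "nat \<Rightarrow> nat \<Rightarrow> (nat \<Rightarrow> nat set) \<Rightarrow> bool" where
  "block_partition k n G \<longleftrightarrow>
     disjoint_family_on G {1..k} \<and> (\<Union>i\<in>{1..k}. G i) = {1..k * n} \<and> (\<forall>i\<in>{1..k}. card (G i) = n)"

definition block_mean :: "nat \<Rightarrow> nat set \<Rightarrow> (nat \<Rightarrow> real) \<Rightarrow> real" where
  "block_mean n B x = (1 / real n) * (\<Sum>l\<in>B. x l)"

definition block_sd :: "nat \<Rightarrow> nat set \<Rightarrow> (nat \<Rightarrow> real) \<Rightarrow> real" where
  "block_sd n B x = sqrt ((1 / real n) * (\<Sum>l\<in>B. (x l - block_mean n B x)\<^sup>2))"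

definition block_weight ::
  "real \<Rightarrow> nat \<Rightarrow> nat \<Rightarrow> (nat \<Rightarrow> nat set) \<Rightarrow> (nat \<Rightarrow> real) \<Rightarrow> nat \<Rightarrow> real" where
  "block_weight p k n G x i =
     (1 / block_sd n (G i) x powr p) / (\<Sum>l\<in>{1..k}. 1 / block_sd n (G l) x powr p)"

text \<open>The argument \<open>d\<close> is the value of the estimator when some block standard deviation vanishes.\<close>

definition weighted_block_mean ::
  "real \<Rightarrow> real \<Rightarrow> nat \<Rightarrow> nat \<Rightarrow> (nat \<Rightarrow> nat set) \<Rightarrow> (nat \<Rightarrow> real) \<Rightarrow> real" where
  "weighted_block_mean d p k n G x =
     (if \<forall>i\<in>{1..k}. block_sd n (G i) x > 0
      then \<Sum>i\<in>{1..k}. block_weight p k n G x i * block_mean n (G i) x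
      else d)"

text \<open>The library has \<open>0 powr 0 = 0\<close>; here \<open>0 ^ 0 = 1\<close> is needed (it matters for \<open>\<delta> = 2\<close>).\<close>

definition powr_one :: "real \<Rightarrow> real \<Rightarrow> real" where
  "powr_one x a = (if a = 0 then 1 else x powr a)"

definition tail_moment :: "'a measure \<Rightarrow> ('a \<Rightarrow> real) \<Rightarrow> real \<Rightarrow> real \<Rightarrow> real \<Rightarrow> real" where
  "tail_moment P X \<mu> \<delta> u =
     (\<integral>\<omega>. \<bar>X \<omega> - \<mu>\<bar> powr (1 + \<delta>) * indicator {\<omega>. \<bar>X \<omega> - \<mu>\<bar> \<ge> u} \<omega> \<partial>P)"

definition phi :: "'a measure \<Rightarrow> ('a \<Rightarrow> real) \<Rightarrow> real \<Rightarrow> real \<Rightarrow> nat \<Rightarrow> real" where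
  "phi P X \<mu> \<delta> n =
     real n powr (- \<delta> / 2) *
     max (real n powr (- ((2 - \<delta>) / 4)))
         (powr_one (tail_moment P X \<mu> \<delta> (real n powr (1 / 4))) ((2 - \<delta>) / (2 + \<delta>)))"

end

theory Submission
  imports Defs
begin

text \<open>Centre the observations at \<open>\<mu>\<close>, put \<open>s = \<sigma>\<^sup>2\<close>, and let \<open>v i\<close> and \<open>S i\<close> be the empirical variance and the
normalised sum \<open>n powr (-1/2) * (\<Sum>l\<in>G i. X l)\<close> of block \<open>i\<close>. The weight of block \<open>i\<close> is proportional to
\<open>1 + h (v i)\<close>, where \<open>h v = (s / v) powr (p / 2) - 1\<close> measures by how much it deviates from the weight
that the true variance would give. Hence the normalised error of the estimator is exactly
\<open>(R + T) / (1 + H)\<close>, where \<open>R\<close> is the normalised sum of all \<open>N\<close> observations, \<open>H\<close> is the average of the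
\<open>h (v i)\<close>, and \<open>T = k powr (-1/2) * (\<Sum>i. h (v i) * S i)\<close>
(lemma \<open>weighted_block_mean_decomposition\<close>). The central limit theorem applies to \<open>R\<close>, so it suffices
that \<open>T\<close> and \<open>H\<close> tend to zero in probability. For \<open>H\<close> this is the law of large numbers inside one block.

The heart of the matter is \<open>T\<close>, a sum of \<open>k\<close> independent terms divided by \<open>sqrt k\<close>. Its second moment is
at most \<open>E (h (v 1) * S 1)\<^sup>2 + k * (E (h (v 1) * S 1))\<^sup>2\<close>. The first summand vanishes because \<open>v 1\<close> is
close to \<open>s\<close> and \<open>(S 1)\<^sup>2\<close> is uniformly integrable (lemma \<open>weighted_second_moment\<close>). The second one
is the accumulated bias of the blocks, and it is what the rate \<open>\<phi>\<close> controls. Replace \<open>v 1\<close> by the mean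
square \<open>V\<close> of the block, which costs only \<open>O (n powr (-1/2))\<close>, and leave out one observation: if \<open>V'\<close> is
\<open>V\<close> without the summand \<open>x\<^sup>2 / n\<close> of the observation \<open>x\<close>, then \<open>h V'\<close> is independent of the centred \<open>x\<close>,
so \<open>E (h V * x) = E ((h V - h V') * x)\<close>, which a bounded Lipschitz \<open>h\<close> makes at most a constant times
\<open>E (\<bar>x\<bar> * min 1 (x\<^sup>2 / n))\<close>. Adding the \<open>n\<close> observations gives a bias of order
\<open>sqrt n * E (\<bar>x\<bar> * min 1 (x\<^sup>2 / n))\<close> (lemma \<open>bias\<close>), and splitting this expectation at
\<open>\<bar>x\<bar> = n powr (1/4)\<close> bounds it by a multiple of \<open>sqrt n * \<phi> \<delta> n\<close> (lemma \<open>bias_integral_le_phi\<close>). So the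
hypothesis \<open>sqrt (k * n) * \<phi> \<delta> n \<longrightarrow> 0\<close> makes \<open>k\<close> times the squared bias vanish. As \<open>\<phi> \<delta> n\<close> is at least
\<open>1 / n\<close>, it also gives \<open>k / n \<longrightarrow> 0\<close>.

The function \<open>h\<close> is singular at zero. The lower tail of an empirical variance is light under a second
moment alone, because truncating the observations can only decrease their mean square: with
probability \<open>1 - O (1 / n)\<close> a block has \<open>v i > s / 4\<close> (lemma \<open>prob_sample_var_small\<close>). Since
\<open>k / n \<longrightarrow> 0\<close>, all blocks have this property with probability tending to one; there the
estimator is the weighted mean, and \<open>h\<close> agrees with a bounded Lipschitz function.\<close>


section \<open>Moments of sums of independent variables\<close>


lemma (in prob_space) indep_vars_pair:
  assumes "indep_vars (\<lambda>_. borel) A I" "i \<in> I" "j \<in> I" "i \<noteq> j"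
  shows "indep_var borel (A i) borel (A j :: _ \<Rightarrow> real)"
proof -
  have "indep_vars (\<lambda>_. borel) A (insert i {j})"
    by (rule indep_vars_subset[OF assms(1)]) (use assms in auto)
  from indep_vars_sum[OF _ _ this] show ?thesis using assms by simp
qed

text \<open>By independence the off-diagonal products contribute only through the means, so the bound separates
fluctuation, linear in the number of summands, from bias, quadratic in it.\<close>

lemma (in prob_space) expectation_sq_sum_le:
  fixes A :: "'i \<Rightarrow> 'a \<Rightarrow> real" and e b :: real
  assumes ind: "indep_vars (\<lambda>_. borel) A I" and fin: "finite I"
    and sq: "\<And>i. i \<in> I \<Longrightarrow> integrable M (\<lambda>\<omega>. (A i \<omega>)\<^sup>2)"
    and e: "\<And>i. i \<in> I \<Longrightarrow> expectation (\<lambda>\<omega>. (A i \<omega>)\<^sup>2) \<le> e"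
    and b: "\<And>i. i \<in> I \<Longrightarrow> \<bar>expectation (A i)\<bar> \<le> b"
  shows "integrable M (\<lambda>\<omega>. (\<Sum>i\<in>I. A i \<omega>)\<^sup>2)"
    and "expectation (\<lambda>\<omega>. (\<Sum>i\<in>I. A i \<omega>)\<^sup>2) \<le> real (card I) * e + (real (card I) * b)\<^sup>2"
proof -
  have rv: "random_variable borel (A i)" if "i \<in> I" for i
    using ind that unfolding indep_vars_def2 by auto
  have int: "integrable M (A i)" if "i \<in> I" for i
    using square_integrable_imp_integrable[OF rv sq] that by blast
  have b0: "0 \<le> b" if "i \<in> I" for i using b[OF that] by simp
  have e0: "0 \<le> e" if "i \<in> I" for i
    by (rule order_trans[OF _ e[OF that]]) simp
  have prod: "integrable M (\<lambda>\<omega>. A i \<omega> * A j \<omega>)" if "i \<in> I" "j \<in> I" for i j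
  proof (cases "i = j")
    case True then show ?thesis using sq[OF that(1)] by (simp add: power2_eq_square)
  next
    case False
    from indep_var_integrable[OF indep_vars_pair[OF ind that False] int int] that
    show ?thesis by simp
  qed
  have eq: "(\<lambda>\<omega>. (\<Sum>i\<in>I. A i \<omega>)\<^sup>2) = (\<lambda>\<omega>. \<Sum>i\<in>I. \<Sum>j\<in>I. A i \<omega> * A j \<omega>)"
    by (simp add: power2_eq_square sum_product)
  show "integrable M (\<lambda>\<omega>. (\<Sum>i\<in>I. A i \<omega>)\<^sup>2)"
    unfolding eq using prod by auto
  have "expectation (\<lambda>\<omega>. (\<Sum>i\<in>I. A i \<omega>)\<^sup>2) = (\<Sum>i\<in>I. \<Sum>j\<in>I. expectation (\<lambda>\<omega>. A i \<omega> * A j \<omega>))"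
    unfolding eq using prod by (subst Bochner_Integration.integral_sum; simp add: Bochner_Integration.integral_sum)
  also have "\<dots> \<le> (\<Sum>i\<in>I. \<Sum>j\<in>I. (if i = j then e else 0) + b * b)"
  proof (intro sum_mono)
    fix i j assume ij: "i \<in> I" "j \<in> I"
    show "expectation (\<lambda>\<omega>. A i \<omega> * A j \<omega>) \<le> (if i = j then e else 0) + b * b"
    proof (cases "i = j")
      case True
      then show ?thesis using e[OF ij(1)] b0[OF ij(1)]
        by (simp add: power2_eq_square) (smt (verit) mult_nonneg_nonneg)
    next
      case False
      have "expectation (\<lambda>\<omega>. A i \<omega> * A j \<omega>) = expectation (A i) * expectation (A j)"
        using indep_var_lebesgue_integral[OF indep_vars_pair[OF ind ij False] int int] ij by simp
      also have "\<dots> \<le> \<bar>expectation (A i)\<bar> * \<bar>expectation (A j)\<bar>"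
        by (metis abs_ge_self abs_mult)
      also have "\<dots> \<le> b * b"
        using b ij b0 by (intro mult_mono) auto
      finally show ?thesis using False by simp
    qed
  qed
  also have "\<dots> = real (card I) * e + (real (card I) * b)\<^sup>2"
    using fin by (simp add: sum.distrib power2_eq_square algebra_simps)
  finally show "expectation (\<lambda>\<omega>. (\<Sum>i\<in>I. A i \<omega>)\<^sup>2) \<le> real (card I) * e + (real (card I) * b)\<^sup>2" .
qed

text \<open>Adding a centred variable \<open>a\<close> to an independent centred sum \<open>S\<close> kills the odd cross terms of
\<open>(a + S) ^ 4\<close>, so the fourth moment grows by at most \<open>T ^ 4 + 6 * T\<^sup>2 * E S\<^sup>2\<close>; the factor 3 absorbs this,
since \<open>3 * (c + 1)\<^sup>2 = 3 * c\<^sup>2 + 6 * c + 3\<close>. With \<open>T\<close> a truncation level,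
this controls the squares of normalised sums uniformly in the number of summands.\<close>

lemma (in prob_space) expectation_pow4_sum_le:
  fixes A :: "'i \<Rightarrow> 'a \<Rightarrow> real" and T :: real
  assumes "indep_vars (\<lambda>_. borel) A I" and "finite I"
    and "\<And>i \<omega>. i \<in> I \<Longrightarrow> \<bar>A i \<omega>\<bar> \<le> T" and "T \<ge> 0"
    and "\<And>i. i \<in> I \<Longrightarrow> expectation (A i) = 0"
  shows "expectation (\<lambda>\<omega>. (\<Sum>i\<in>I. A i \<omega>) ^ 4) \<le> 3 * (real (card I))\<^sup>2 * T ^ 4"
  using assms(2,1,3-)
proof (induction I)
  case empty then show ?case by simp
next
  case (insert i I)
  note ind = insert.prems(1) and T = insert.prems(2) and z = insert.prems(4)
  have rv[measurable]: "random_variable borel (A j)" if "j \<in> insert i I" for j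
    using ind that unfolding indep_vars_def2 by auto
  define S where "S \<omega> = (\<Sum>j\<in>I. A j \<omega>)" for \<omega>
  have [measurable]: "S \<in> borel_measurable M" unfolding S_def by (intro borel_measurable_sum rv) auto
  have [measurable]: "A i \<in> borel_measurable M" by (intro rv) auto
  have Sb: "\<bar>S \<omega>\<bar> \<le> card I * T" for \<omega>
    unfolding S_def by (rule order_trans[OF sum_abs]) (use T in \<open>auto intro!: sum_bounded_above[THEN order_trans]\<close>)
  have Ab: "\<bar>A i \<omega>\<bar> \<le> T" for \<omega> using T by auto
  have intS: "integrable M (\<lambda>\<omega>. S \<omega> ^ r)" for r
    by (rule integrable_const_bound[where B="(card I * T) ^ r"])
      (use Sb in \<open>auto intro!: power_mono simp: power_abs\<close>)
  have intA: "integrable M (\<lambda>\<omega>. A i \<omega> ^ r)" for r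
    by (rule integrable_const_bound[where B="T ^ r"])
      (use Ab in \<open>auto intro!: power_mono simp: power_abs\<close>)
  have iv: "indep_var borel (A i) borel S"
    unfolding S_def[abs_def] using indep_vars_sum[OF insert.hyps(1,2) ind] .
  have iv': "indep_var borel (\<lambda>\<omega>. A i \<omega> ^ a) borel (\<lambda>\<omega>. S \<omega> ^ b)" for a b
    using indep_var_compose[OF iv, of "\<lambda>x. x ^ a" borel "\<lambda>x. x ^ b" borel] by (simp add: comp_def)
  have prod: "expectation (\<lambda>\<omega>. A i \<omega> ^ a * S \<omega> ^ b) = expectation (\<lambda>\<omega>. A i \<omega> ^ a) * expectation (\<lambda>\<omega>. S \<omega> ^ b)"
    "integrable M (\<lambda>\<omega>. A i \<omega> ^ a * S \<omega> ^ b)" for a b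
    using indep_var_lebesgue_integral[OF iv' intA intS] indep_var_integrable[OF iv' intA intS] by auto
  have indI: "indep_vars (\<lambda>_. borel) A I" by (rule indep_vars_subset[OF ind]) auto
  have ES: "expectation S = 0"
    unfolding S_def[abs_def] using z intA[of 1] 
    by (subst Bochner_Integration.integral_sum)
      (auto intro!: integrable_const_bound[where B=T] simp: T)
  have ES2: "expectation (\<lambda>\<omega>. S \<omega> ^ 2) \<le> real (card I) * T\<^sup>2"
  proof -
    have sq: "(A j \<omega>)\<^sup>2 \<le> T\<^sup>2" if "j \<in> I" for j \<omega>
      using T[of j \<omega>] that power_mono[of "\<bar>A j \<omega>\<bar>" T 2] by auto
    have "expectation (\<lambda>\<omega>. (\<Sum>i\<in>I. A i \<omega>)\<^sup>2) \<le> real (card I) * T\<^sup>2 + (real (card I) * 0)\<^sup>2"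
    proof (rule expectation_sq_sum_le(2)[OF indI insert.hyps(1)])
      fix j assume j: "j \<in> I"
      show int: "integrable M (\<lambda>\<omega>. (A j \<omega>)\<^sup>2)"
        by (rule integrable_const_bound[where B="T\<^sup>2"]) (use sq j in auto)
      show "expectation (\<lambda>\<omega>. (A j \<omega>)\<^sup>2) \<le> T\<^sup>2"
        using integral_mono[OF int, of "\<lambda>_. T\<^sup>2"] sq j by (auto simp: prob_space)
      show "\<bar>expectation (A j)\<bar> \<le> 0" using z j by auto
    qed
    then show ?thesis by (simp add: S_def)
  qed
  have EA2: "expectation (\<lambda>\<omega>. A i \<omega> ^ 2) \<le> T\<^sup>2" and EA4: "expectation (\<lambda>\<omega>. A i \<omega> ^ 4) \<le> T^4"
    using integral_mono[OF intA[of 2], of "\<lambda>_. T\<^sup>2"] integral_mono[OF intA[of 4], of "\<lambda>_. T^4"]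
      power_mono[OF Ab, of _ 2] power_mono[OF Ab, of _ 4]
    by (auto simp: prob_space)
  have EA: "expectation (A i) = 0" using z by auto
  have IH: "expectation (\<lambda>\<omega>. S \<omega> ^ 4) \<le> 3 * (real (card I))\<^sup>2 * T ^ 4"
    unfolding S_def using insert.IH[OF indI] T z insert.prems by auto
  have "expectation (\<lambda>\<omega>. (\<Sum>j\<in>insert i I. A j \<omega>) ^ 4) =
      expectation (\<lambda>\<omega>. A i \<omega> ^ 4 + 4 * (A i \<omega> ^ 3 * S \<omega>) + 6 * (A i \<omega> ^ 2 * S \<omega> ^ 2)
        + 4 * (A i \<omega> * S \<omega> ^ 3) + S \<omega> ^ 4)"
    using insert.hyps by (intro Bochner_Integration.integral_cong)
      (auto simp: S_def[symmetric] power4_eq_xxxx power3_eq_cube power2_eq_square algebra_simps)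
  also have "\<dots> = expectation (\<lambda>\<omega>. A i \<omega> ^ 4) + 4 * (expectation (\<lambda>\<omega>. A i \<omega> ^ 3) * expectation S)
     + 6 * (expectation (\<lambda>\<omega>. A i \<omega> ^ 2) * expectation (\<lambda>\<omega>. S \<omega> ^ 2))
     + 4 * (expectation (A i) * expectation (\<lambda>\<omega>. S \<omega> ^ 3)) + expectation (\<lambda>\<omega>. S \<omega> ^ 4)"
    using prod(1)[of 3 1] prod(1)[of 2 2] prod(1)[of 1 3] prod(2)[of 3 1] prod(2)[of 2 2] prod(2)[of 1 3] intA intS
    by simp
  also have "\<dots> = expectation (\<lambda>\<omega>. A i \<omega> ^ 4)
     + 6 * (expectation (\<lambda>\<omega>. A i \<omega> ^ 2) * expectation (\<lambda>\<omega>. S \<omega> ^ 2)) + expectation (\<lambda>\<omega>. S \<omega> ^ 4)"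
    by (simp add: ES EA)
  also have "\<dots> \<le> T^4 + 6 * (T\<^sup>2 * (real (card I) * T\<^sup>2)) + 3 * (real (card I))\<^sup>2 * T ^ 4"
    by (intro add_mono mult_left_mono mult_mono EA4 EA2 ES2 IH) auto
  also have "\<dots> \<le> 3 * (real (card (insert i I)))\<^sup>2 * T ^ 4"
    using insert.hyps zero_le_power[OF insert.prems(3), of 4]
    by (simp add: power2_eq_square power4_eq_xxxx algebra_simps)
  finally show ?case .
qed

lemma (in prob_space) expectation_abs_le_sqrt:
  assumes [measurable]: "Y \<in> borel_measurable M" and "integrable M (\<lambda>\<omega>. (Y \<omega> :: real)\<^sup>2)"
  shows "expectation (\<lambda>\<omega>. \<bar>Y \<omega>\<bar>) \<le> sqrt (expectation (\<lambda>\<omega>. (Y \<omega>)\<^sup>2))"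
proof -
  have int: "integrable M (\<lambda>\<omega>. \<bar>Y \<omega>\<bar>)"
    by (rule square_integrable_imp_integrable) (use assms in simp_all)
  have "(expectation (\<lambda>\<omega>. \<bar>Y \<omega>\<bar>))\<^sup>2 \<le> expectation (\<lambda>\<omega>. \<bar>Y \<omega>\<bar>\<^sup>2)"
    using variance_eq[OF int] variance_positive[of "\<lambda>\<omega>. \<bar>Y \<omega>\<bar>"] assms(2) by simp
  then show ?thesis
    by (intro real_le_rsqrt) simp
qed

section \<open>One block of independent observations\<close>


definition root_sum :: "nat set \<Rightarrow> (nat \<Rightarrow> real) \<Rightarrow> real" where
  "root_sum B z = (\<Sum>l\<in>B. z l) / sqrt (real (card B))"

definition mean_square :: "nat set \<Rightarrow> (nat \<Rightarrow> real) \<Rightarrow> real" where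
  "mean_square B z = (\<Sum>l\<in>B. (z l)\<^sup>2) / real (card B)"

definition sample_var :: "nat set \<Rightarrow> (nat \<Rightarrow> real) \<Rightarrow> real" where
  "sample_var B z = mean_square B z - (root_sum B z)\<^sup>2 / real (card B)"

definition tail_second_moment :: "real measure \<Rightarrow> real \<Rightarrow> real" where
  "tail_second_moment \<nu> T = (\<integral>x. x\<^sup>2 * indicator {x. \<bar>x\<bar> > T} x \<partial>\<nu>)"

text \<open>A block \<open>B\<close> of independent centred observations \<open>Z l\<close> with common law \<open>\<nu>\<close> and variance \<open>s\<close>. All bounds
below depend on the block only through its size, so they hold uniformly over the blocks of an array.\<close>

locale iid_block = prob_space M for M :: "'b measure" +
  fixes Z :: "nat \<Rightarrow> 'b \<Rightarrow> real" and B :: "nat set" and \<nu> :: "real measure" and s :: real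
  assumes fin: "finite B" and nonempty: "B \<noteq> {}"
    and indep: "indep_vars (\<lambda>_. borel) Z B"
    and distr: "\<And>l. l \<in> B \<Longrightarrow> distr M borel (Z l) = \<nu>"
    and sq: "integrable \<nu> (\<lambda>x. x\<^sup>2)"
    and mean: "(\<integral>x. x \<partial>\<nu>) = 0"
    and second: "(\<integral>x. x\<^sup>2 \<partial>\<nu>) = s"
begin

abbreviation n :: real where "n \<equiv> real (card B)"
abbreviation S :: "'b \<Rightarrow> real" where "S \<omega> \<equiv> root_sum B (\<lambda>l. Z l \<omega>)"
abbreviation V :: "'b \<Rightarrow> real" where "V \<omega> \<equiv> mean_square B (\<lambda>l. Z l \<omega>)"
abbreviation v :: "'b \<Rightarrow> real" where "v \<omega> \<equiv> sample_var B (\<lambda>l. Z l \<omega>)"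

lemma n_pos: "n > 0"
  using fin nonempty by (simp add: card_gt_0_iff)

lemma rv [measurable]: "l \<in> B \<Longrightarrow> Z l \<in> borel_measurable M"
  using indep unfolding indep_vars_def2 by auto

lemma sets_nu [measurable_cong]: "sets \<nu> = sets borel"
  and prob_nu: "prob_space \<nu>"
proof -
  obtain l where "l \<in> B" using nonempty by auto
  then show "sets \<nu> = sets borel" "prob_space \<nu>"
    using distr[of l] prob_space_distr[of "Z l" borel] rv[of l] by (metis sets_distr)+
qed

lemma space_nu [simp]: "space \<nu> = UNIV"
  using sets_eq_imp_space_eq[OF sets_nu] by simp

lemma rv_sums [measurable]: "S \<in> borel_measurable M" "V \<in> borel_measurable M" "v \<in> borel_measurable M"
  unfolding sample_var_def root_sum_def mean_square_def by measurable

lemma integral_observation: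
  assumes [measurable]: "f \<in> borel_measurable borel" and l: "l \<in> B"
  shows "expectation (\<lambda>\<omega>. f (Z l \<omega>) :: real) = (\<integral>x. f x \<partial>\<nu>)"
    and "integrable M (\<lambda>\<omega>. f (Z l \<omega>)) \<longleftrightarrow> integrable \<nu> f"
  using integral_distr[of "Z l" M borel f] integrable_distr_eq[of "Z l" M borel f] rv[OF l]
  by (simp_all add: distr[OF l])

lemma integrable_nu_bounded:
  assumes "f \<in> borel_measurable borel" and "\<And>x. \<bar>f x\<bar> \<le> c * x\<^sup>2"
  shows "integrable \<nu> (f :: real \<Rightarrow> real)"
  by (rule Bochner_Integration.integrable_bound[of _ "\<lambda>x. c * x\<^sup>2"])
    (use sq assms order_trans[OF assms(2) abs_ge_self] in auto)

lemma integrable_nu: "integrable \<nu> (\<lambda>x. x)"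
proof -
  interpret nu: prob_space \<nu> by (rule prob_nu)
  show ?thesis by (rule nu.square_integrable_imp_integrable[OF _ sq]) measurable
qed

lemma second_moment_sum:
  assumes [measurable]: "f \<in> borel_measurable borel"
    and fsq: "integrable \<nu> (\<lambda>x. (f x)\<^sup>2)" and f0: "(\<integral>x. f x \<partial>\<nu>) = (0::real)"
  shows "integrable M (\<lambda>\<omega>. (\<Sum>l\<in>B. f (Z l \<omega>))\<^sup>2)"
    and "expectation (\<lambda>\<omega>. (\<Sum>l\<in>B. f (Z l \<omega>))\<^sup>2) \<le> n * (\<integral>x. (f x)\<^sup>2 \<partial>\<nu>)"
proof -
  have ind: "indep_vars (\<lambda>_. borel) (\<lambda>l \<omega>. f (Z l \<omega>)) B"
    by (rule indep_vars_compose2[OF indep]) simp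
  have 1: "integrable M (\<lambda>\<omega>. (f (Z l \<omega>))\<^sup>2)"
    "expectation (\<lambda>\<omega>. (f (Z l \<omega>))\<^sup>2) \<le> (\<integral>x. (f x)\<^sup>2 \<partial>\<nu>)"
    "\<bar>expectation (\<lambda>\<omega>. f (Z l \<omega>))\<bar> \<le> 0" if "l \<in> B" for l
    using integral_observation[of "\<lambda>x. (f x)\<^sup>2" l] integral_observation[of f l] that fsq f0 by auto
  from expectation_sq_sum_le[OF ind fin 1]
  show "integrable M (\<lambda>\<omega>. (\<Sum>l\<in>B. f (Z l \<omega>))\<^sup>2)"
    and "expectation (\<lambda>\<omega>. (\<Sum>l\<in>B. f (Z l \<omega>))\<^sup>2) \<le> n * (\<integral>x. (f x)\<^sup>2 \<partial>\<nu>)"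
    by auto
qed

lemma root_sum_sq:
  shows "integrable M (\<lambda>\<omega>. (S \<omega>)\<^sup>2)" and "expectation (\<lambda>\<omega>. (S \<omega>)\<^sup>2) \<le> s"
proof -
  have 1: "(\<lambda>\<omega>. (S \<omega>)\<^sup>2) = (\<lambda>\<omega>. (\<Sum>l\<in>B. Z l \<omega>)\<^sup>2 / n)"
    by (simp add: root_sum_def power_divide)
  show "integrable M (\<lambda>\<omega>. (S \<omega>)\<^sup>2)"
    unfolding 1 using second_moment_sum(1)[of "\<lambda>x. x"] sq mean by auto
  show "expectation (\<lambda>\<omega>. (S \<omega>)\<^sup>2) \<le> s"
    unfolding 1 using second_moment_sum(2)[of "\<lambda>x. x"] sq mean n_pos
    by (auto simp: second field_simps)
qed

lemma indep_rest:
  assumes l: "l \<in> B"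
  shows "indep_var borel (Z l) borel (\<lambda>\<omega>. \<Sum>j\<in>B - {l}. (Z j \<omega>)\<^sup>2)"
proof -
  define A where "A j \<omega> = (if j = l then Z j \<omega> else (Z j \<omega>)\<^sup>2)" for j \<omega>
  have "indep_vars (\<lambda>_. borel) (\<lambda>j \<omega>. (\<lambda>x. if j = l then x else x\<^sup>2) (Z j \<omega>)) B"
    by (rule indep_vars_compose2[OF indep]) simp
  then have "indep_vars (\<lambda>_. borel) A (insert l (B - {l}))"
    using l by (simp add: A_def[abs_def] insert_absorb)
  then have "indep_var borel (A l) borel (\<lambda>\<omega>. \<Sum>j\<in>B - {l}. A j \<omega>)"
    by (intro indep_vars_sum) (use fin in auto)
  moreover have "(\<lambda>\<omega>. \<Sum>j\<in>B - {l}. A j \<omega>) = (\<lambda>\<omega>. \<Sum>j\<in>B - {l}. (Z j \<omega>)\<^sup>2)"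
    by (auto simp: A_def intro!: sum.cong)
  moreover have "A l = Z l" by (auto simp: A_def)
  ultimately show ?thesis by simp
qed

lemma measure_nu [simp]: "measure \<nu> UNIV = 1"
  using prob_space.prob_space[OF prob_nu] by simp

lemma tail_second_moment_split:
  "integrable \<nu> (\<lambda>x. x\<^sup>2 * indicator {x. \<bar>x\<bar> > T} x)"
  "integrable \<nu> (\<lambda>x. x\<^sup>2 * indicator {x. \<bar>x\<bar> \<le> T} x)"
  "(\<integral>x. x\<^sup>2 * indicator {x. \<bar>x\<bar> \<le> T} x \<partial>\<nu>) + tail_second_moment \<nu> T = s"
  "tail_second_moment \<nu> T \<ge> 0"
proof -
  show 1: "integrable \<nu> (\<lambda>x. x\<^sup>2 * indicator {x. \<bar>x\<bar> > T} x)"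
    by (rule integrable_nu_bounded[where c=1]) (auto simp: indicator_def)
  show 2: "integrable \<nu> (\<lambda>x. x\<^sup>2 * indicator {x. \<bar>x\<bar> \<le> T} x)"
    by (rule integrable_nu_bounded[where c=1]) (auto simp: indicator_def)
  have "(\<lambda>x. x\<^sup>2 * indicator {x. \<bar>x\<bar> \<le> T} x + x\<^sup>2 * indicator {x. \<bar>x\<bar> > T} x) = (\<lambda>x. x\<^sup>2 :: real)"
    by (auto simp: indicator_def)
  then show "(\<integral>x. x\<^sup>2 * indicator {x. \<bar>x\<bar> \<le> T} x \<partial>\<nu>) + tail_second_moment \<nu> T = s"
    unfolding tail_second_moment_def second[symmetric]
    using Bochner_Integration.integral_add[OF 2 1] by simp
  show "tail_second_moment \<nu> T \<ge> 0"
    unfolding tail_second_moment_def by (rule Bochner_Integration.integral_nonneg) simp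
qed

definition truncated_ms :: "real \<Rightarrow> 'b \<Rightarrow> real" where
  "truncated_ms T \<omega> = (\<Sum>l\<in>B. (Z l \<omega>)\<^sup>2 * indicator {x. \<bar>x\<bar> \<le> T} (Z l \<omega>)) / n"

lemma rv_truncated_ms [measurable]: "truncated_ms T \<in> borel_measurable M"
  unfolding truncated_ms_def by measurable

lemma truncated_ms_variance:
  assumes "T \<ge> 0"
  shows "integrable M (\<lambda>\<omega>. (truncated_ms T \<omega> - (s - tail_second_moment \<nu> T))\<^sup>2)"
    and "expectation (\<lambda>\<omega>. (truncated_ms T \<omega> - (s - tail_second_moment \<nu> T))\<^sup>2) \<le> T ^ 4 / n"
proof -
  interpret nu: prob_space \<nu> by (rule prob_nu)
  define a where "a x = x\<^sup>2 * indicator {x. \<bar>x\<bar> \<le> T} x" for x :: real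
  define \<alpha> where "\<alpha> = s - tail_second_moment \<nu> T"
  have [measurable]: "a \<in> borel_measurable borel" unfolding a_def by measurable
  have int_a: "integrable \<nu> a" and \<alpha>: "(\<integral>x. a x \<partial>\<nu>) = \<alpha>"
    using tail_second_moment_split(2,3)[of T] by (auto simp: a_def[abs_def] \<alpha>_def)
  have a_range: "0 \<le> a x" "a x \<le> T\<^sup>2" for x
    using power_mono[of "\<bar>x\<bar>" T 2] by (auto simp: a_def indicator_def)
  have "\<alpha> \<le> T\<^sup>2" "0 \<le> \<alpha>"
    using integral_mono[OF int_a, of "\<lambda>_. T\<^sup>2"] a_range Bochner_Integration.integral_nonneg[of \<nu> a]
    by (auto simp: \<alpha> nu.prob_space)
  then have "\<bar>a x - \<alpha>\<bar> \<le> T\<^sup>2" for x using a_range[of x] by linarith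
  from power_mono[OF this, of _ 2] have le: "(a x - \<alpha>)\<^sup>2 \<le> T ^ 4" for x by simp
  have int: "integrable \<nu> (\<lambda>x. (a x - \<alpha>)\<^sup>2)"
    by (rule nu.integrable_const_bound[where B="T ^ 4"]) (use le in auto)
  have le: "(\<integral>x. (a x - \<alpha>)\<^sup>2 \<partial>\<nu>) \<le> T ^ 4"
    using integral_mono[OF int, of "\<lambda>_. T ^ 4"] le by (simp add: nu.prob_space)
  have zero: "(\<integral>x. a x - \<alpha> \<partial>\<nu>) = 0"
    using int_a \<alpha> by (simp add: nu.prob_space)
  have eq: "(\<lambda>\<omega>. (truncated_ms T \<omega> - (s - tail_second_moment \<nu> T))\<^sup>2) = (\<lambda>\<omega>. (\<Sum>l\<in>B. a (Z l \<omega>) - \<alpha>)\<^sup>2 / n\<^sup>2)"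
    using n_pos by (auto simp: truncated_ms_def a_def[symmetric] \<alpha>_def[symmetric] sum_subtractf power_divide[symmetric] diff_divide_distrib)
  note sm = second_moment_sum[of "\<lambda>x. a x - \<alpha>", OF _ int zero]
  show "integrable M (\<lambda>\<omega>. (truncated_ms T \<omega> - (s - tail_second_moment \<nu> T))\<^sup>2)"
    unfolding eq using sm(1) by simp
  have "expectation (\<lambda>\<omega>. (truncated_ms T \<omega> - (s - tail_second_moment \<nu> T))\<^sup>2) \<le> n * (\<integral>x. (a x - \<alpha>)\<^sup>2 \<partial>\<nu>) / n\<^sup>2"
    unfolding eq using sm(2) by (simp add: divide_right_mono)
  also have "\<dots> \<le> n * T ^ 4 / n\<^sup>2"
    by (intro divide_right_mono mult_left_mono le) auto
  also have "\<dots> = T ^ 4 / n" using n_pos by (simp add: power2_eq_square)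
  finally show "expectation (\<lambda>\<omega>. (truncated_ms T \<omega> - (s - tail_second_moment \<nu> T))\<^sup>2) \<le> T ^ 4 / n" .
qed

text \<open>Only the second moment of an observation is available, so the mean square need not have a finite variance.
Its truncated part does, which gives \<open>T\<^sup>2 / sqrt n\<close>, and the tail is handled in mean. The term
\<open>s / n\<close> is the squared block mean.\<close>

lemma sample_var_L1:
  assumes T: "T \<ge> 0"
  shows "integrable M (\<lambda>\<omega>. \<bar>v \<omega> - s\<bar>)"
    and "expectation (\<lambda>\<omega>. \<bar>v \<omega> - s\<bar>) \<le> 2 * tail_second_moment \<nu> T + T\<^sup>2 / sqrt n + s / n"
proof -
  let ?\<tau> = "tail_second_moment \<nu> T"
  define b where "b \<omega> = (\<Sum>l\<in>B. (Z l \<omega>)\<^sup>2 * indicator {x. \<bar>x\<bar> > T} (Z l \<omega>)) / n" for \<omega>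
  have V: "V \<omega> = truncated_ms T \<omega> + b \<omega>" for \<omega>
    unfolding mean_square_def truncated_ms_def b_def add_divide_distrib[symmetric] sum.distrib[symmetric]
    by (auto simp: indicator_def intro!: arg_cong2[where f="(/)"] sum.cong)
  have b1: "integrable M (\<lambda>\<omega>. (Z l \<omega>)\<^sup>2 * indicator {x. \<bar>x\<bar> > T} (Z l \<omega>))"
    "expectation (\<lambda>\<omega>. (Z l \<omega>)\<^sup>2 * indicator {x. \<bar>x\<bar> > T} (Z l \<omega>)) = ?\<tau>" if "l \<in> B" for l
    using integral_observation[of "\<lambda>x. x\<^sup>2 * indicator {x. \<bar>x\<bar> > T} x" l] that tail_second_moment_split(1)[of T]
    by (simp_all add: tail_second_moment_def)
  have b_int: "integrable M b" unfolding b_def using b1(1) by auto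
  have b_E: "expectation b = ?\<tau>"
    unfolding b_def using b1 n_pos by (simp add: Bochner_Integration.integral_sum)
  have b0: "b \<omega> \<ge> 0" for \<omega> unfolding b_def by (intro divide_nonneg_nonneg sum_nonneg) auto
  let ?t = "\<lambda>\<omega>. truncated_ms T \<omega> - (s - ?\<tau>)"
  have t_int: "integrable M ?t"
    by (rule square_integrable_imp_integrable[OF _ truncated_ms_variance(1)[OF T]]) measurable
  have t_E: "expectation (\<lambda>\<omega>. \<bar>?t \<omega>\<bar>) \<le> T\<^sup>2 / sqrt n"
  proof -
    have "expectation (\<lambda>\<omega>. \<bar>?t \<omega>\<bar>) \<le> sqrt (expectation (\<lambda>\<omega>. (?t \<omega>)\<^sup>2))"
      by (rule expectation_abs_le_sqrt[OF _ truncated_ms_variance(1)[OF T]]) measurable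
    also have "\<dots> \<le> sqrt (T ^ 4 / n)"
      by (rule real_sqrt_le_mono[OF truncated_ms_variance(2)[OF T]])
    also have "sqrt (T ^ 4 / n) = T\<^sup>2 / sqrt n"
      using real_sqrt_abs[of "T\<^sup>2"] by (simp add: real_sqrt_divide)
    finally show ?thesis .
  qed
  have le: "\<bar>v \<omega> - s\<bar> \<le> \<bar>?t \<omega>\<bar> + b \<omega> + ?\<tau> + (S \<omega>)\<^sup>2 / n" for \<omega>
  proof -
    have "v \<omega> - s = ?t \<omega> + b \<omega> - ?\<tau> - (S \<omega>)\<^sup>2 / n"
      by (simp add: sample_var_def V)
    moreover have "0 \<le> (S \<omega>)\<^sup>2 / n" by simp
    ultimately show ?thesis using b0[of \<omega>] tail_second_moment_split(4)[of T] by linarith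
  qed
  have int: "integrable M (\<lambda>\<omega>. \<bar>?t \<omega>\<bar> + b \<omega> + ?\<tau> + (S \<omega>)\<^sup>2 / n)"
    using t_int b_int root_sum_sq(1) by auto
  show vint: "integrable M (\<lambda>\<omega>. \<bar>v \<omega> - s\<bar>)"
  proof (rule Bochner_Integration.integrable_bound[OF int])
    show "AE \<omega> in M. norm \<bar>v \<omega> - s\<bar> \<le> norm (\<bar>?t \<omega>\<bar> + b \<omega> + ?\<tau> + (S \<omega>)\<^sup>2 / n)"
      using order_trans[OF le abs_ge_self] by simp
  qed measurable
  have "expectation (\<lambda>\<omega>. \<bar>v \<omega> - s\<bar>) \<le> expectation (\<lambda>\<omega>. \<bar>?t \<omega>\<bar> + b \<omega> + ?\<tau> + (S \<omega>)\<^sup>2 / n)"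
    by (rule integral_mono[OF vint int le])
  also have "\<dots> = expectation (\<lambda>\<omega>. \<bar>?t \<omega>\<bar>) + ?\<tau> + ?\<tau> + expectation (\<lambda>\<omega>. (S \<omega>)\<^sup>2) / n"
    using t_int b_int root_sum_sq(1) b_E by (simp add: prob_space)
  also have "\<dots> \<le> T\<^sup>2 / sqrt n + ?\<tau> + ?\<tau> + s / n"
    by (intro add_mono t_E divide_right_mono root_sum_sq(2)) auto
  finally show "expectation (\<lambda>\<omega>. \<bar>v \<omega> - s\<bar>) \<le> 2 * ?\<tau> + T\<^sup>2 / sqrt n + s / n"
    by simp
qed

text \<open>If the variance is at most \<open>s / 4\<close>, then the squared block mean is at least \<open>s / 4\<close> or the truncated mean
square is at most \<open>s / 2\<close>, which is \<open>s / 4\<close> below its own mean. Chebyshev gives both events probability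
\<open>O (1 / n)\<close>. Without truncation the second event would need a fourth moment.\<close>

lemma prob_sample_var_small:
  assumes T: "T \<ge> 0" and \<tau>: "tail_second_moment \<nu> T \<le> s / 4" and s: "s > 0"
  shows "prob {\<omega> \<in> space M. v \<omega> \<le> s / 4} \<le> (16 * T ^ 4 / s\<^sup>2 + 4) / n"
proof -
  let ?\<tau> = "tail_second_moment \<nu> T"
  let ?t = "\<lambda>\<omega>. (truncated_ms T \<omega> - (s - ?\<tau>))\<^sup>2"
  have "{\<omega> \<in> space M. v \<omega> \<le> s / 4} \<subseteq>
    {\<omega> \<in> space M. ?t \<omega> \<ge> s\<^sup>2 / 16} \<union> {\<omega> \<in> space M. (S \<omega>)\<^sup>2 / n \<ge> s / 4}"
  proof safe
    fix \<omega> assume w: "\<omega> \<in> space M" "v \<omega> \<le> s / 4" "\<not> s / 4 \<le> (S \<omega>)\<^sup>2 / n"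
    have "truncated_ms T \<omega> \<le> V \<omega>"
      unfolding truncated_ms_def mean_square_def
      by (intro divide_right_mono sum_mono) (auto simp: indicator_def)
    also have "V \<omega> \<le> s / 2"
      using w by (simp add: sample_var_def)
    finally have "s / 4 \<le> (s - ?\<tau>) - truncated_ms T \<omega>" using \<tau> by linarith
    then have "(s / 4)\<^sup>2 \<le> ((s - ?\<tau>) - truncated_ms T \<omega>)\<^sup>2"
      using s by (intro power_mono) auto
    then show "s\<^sup>2 / 16 \<le> ?t \<omega>"
      by (simp add: power_divide power2_commute)
  qed
  then have "prob {\<omega> \<in> space M. v \<omega> \<le> s / 4} \<le>
     prob ({\<omega> \<in> space M. ?t \<omega> \<ge> s\<^sup>2 / 16} \<union> {\<omega> \<in> space M. (S \<omega>)\<^sup>2 / n \<ge> s / 4})"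
    by (rule finite_measure_mono) measurable
  also have "\<dots> \<le> prob {\<omega> \<in> space M. ?t \<omega> \<ge> s\<^sup>2 / 16} + prob {\<omega> \<in> space M. (S \<omega>)\<^sup>2 / n \<ge> s / 4}"
    by (rule measure_Un_le) measurable
  also have "prob {\<omega> \<in> space M. ?t \<omega> \<ge> s\<^sup>2 / 16} \<le> expectation ?t / (s\<^sup>2 / 16)"
    by (rule integral_Markov_inequality_measure[where A="space M", OF truncated_ms_variance(1)[OF T]]) (use s in auto)
  also have "\<dots> \<le> (T ^ 4 / n) / (s\<^sup>2 / 16)"
    by (rule divide_right_mono[OF truncated_ms_variance(2)[OF T]]) simp
  also have "prob {\<omega> \<in> space M. (S \<omega>)\<^sup>2 / n \<ge> s / 4} \<le> expectation (\<lambda>\<omega>. (S \<omega>)\<^sup>2 / n) / (s / 4)"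
    by (rule integral_Markov_inequality_measure[where A="space M"]) (use s root_sum_sq(1) in auto)
  also have "\<dots> \<le> (s / n) / (s / 4)"
    using root_sum_sq(2) s by (intro divide_right_mono) (simp_all add: divide_right_mono)
  also have "(T ^ 4 / n) / (s\<^sup>2 / 16) + (s / n) / (s / 4) = (16 * T ^ 4 / s\<^sup>2 + 4) / n"
    using s n_pos by (simp add: field_simps)
  finally show ?thesis by simp
qed

text \<open>All that matters of the weights is a bounded Lipschitz function \<open>h\<close> of the block variance that
vanishes at \<open>s\<close>; one constant \<open>K\<close> for both properties keeps the bounds short.\<close>

context
  fixes h :: "real \<Rightarrow> real" and K :: real
  assumes h_meas [measurable]: "h \<in> borel_measurable borel"
    and h_lip: "\<And>u w. \<bar>h u - h w\<bar> \<le> K * min 1 \<bar>u - w\<bar>"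
    and h_s: "h s = 0"
begin

lemma h_le: "\<bar>h u\<bar> \<le> K * min 1 \<bar>u - s\<bar>"
  using h_lip[of u s] h_s by simp

lemma K_nonneg: "K \<ge> 0"
  using order_trans[OF abs_ge_zero h_lip[of "1" "0"]] by simp

lemma h_bound: "\<bar>h u\<bar> \<le> K"
proof -
  have "K * min 1 \<bar>u - s\<bar> \<le> K * 1" by (rule mult_left_mono) (simp_all add: K_nonneg)
  with h_le[of u] show ?thesis by linarith
qed

text \<open>Leave one observation out: the mean square \<open>Q\<close> of the others is independent of \<open>Z l\<close>, which is centred,
so \<open>h Q * Z l\<close> has mean zero and only the increment \<open>h V - h Q\<close> counts. That increment is caused by a
perturbation of size \<open>(Z l)\<^sup>2 / n\<close>.\<close>

lemma bias_mean_square: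
  "\<bar>expectation (\<lambda>\<omega>. h (V \<omega>) * S \<omega>)\<bar> \<le> K * sqrt n * (\<integral>x. \<bar>x\<bar> * min 1 (x\<^sup>2 / n) \<partial>\<nu>)"
proof -
  let ?\<beta> = "\<integral>x. \<bar>x\<bar> * min 1 (x\<^sup>2 / n) \<partial>\<nu>"
  have intZ: "integrable M (Z l)" if "l \<in> B" for l
    by (rule iffD2[OF integral_observation(2)[of "\<lambda>x. x" l] integrable_nu]) (simp_all add: that)
  have inthZ: "integrable M (\<lambda>\<omega>. h (g \<omega>) * Z l \<omega>)"
    if l: "l \<in> B" and [measurable]: "g \<in> borel_measurable M" for l g
  proof -
    have [measurable]: "Z l \<in> borel_measurable M" using l by (rule rv)
    show ?thesis
      by (rule Bochner_Integration.integrable_bound[of _ "\<lambda>\<omega>. K * Z l \<omega>"])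
        (use intZ[OF l] mult_right_mono[OF h_bound abs_ge_zero] K_nonneg in \<open>simp_all add: abs_mult\<close>)
  qed
  have one: "\<bar>expectation (\<lambda>\<omega>. h (V \<omega>) * Z l \<omega>)\<bar> \<le> K * ?\<beta>" if l: "l \<in> B" for l
  proof -
    have [measurable]: "Z l \<in> borel_measurable M" using l by (rule rv)
    \<comment> \<open>The divisor stays \<open>n\<close>, not \<open>n - 1\<close>, so that \<open>V - Q\<close> is a single summand.\<close>
    define Q where "Q \<omega> = (\<Sum>j\<in>B - {l}. (Z j \<omega>)\<^sup>2) / n" for \<omega>
    have Qm[measurable]: "Q \<in> borel_measurable M" unfolding Q_def by measurable
    have "indep_var borel (Z l) borel (\<lambda>\<omega>. h (Q \<omega>))"
      unfolding Q_def
      using indep_var_compose[OF indep_rest[OF l], of "\<lambda>x. x" borel "\<lambda>x. h (x / n)" borel]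
      by (simp add: comp_def)
    moreover have "integrable M (\<lambda>\<omega>. h (Q \<omega>))"
      by (rule integrable_const_bound[where B=K]) (simp_all add: h_bound)
    ultimately have "expectation (\<lambda>\<omega>. Z l \<omega> * h (Q \<omega>)) = expectation (Z l) * expectation (\<lambda>\<omega>. h (Q \<omega>))"
      by (intro indep_var_lebesgue_integral intZ[OF l])
    then have z: "expectation (\<lambda>\<omega>. h (Q \<omega>) * Z l \<omega>) = 0"
      using integral_observation(1)[of "\<lambda>x. x" l] l mean by (simp add: mult.commute)
    have VQ: "V \<omega> - Q \<omega> = (Z l \<omega>)\<^sup>2 / n" for \<omega>
      unfolding mean_square_def Q_def using fin l
      by (simp add: sum.remove[of B l] diff_divide_distrib[symmetric])
    have "expectation (\<lambda>\<omega>. h (V \<omega>) * Z l \<omega>) =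
        expectation (\<lambda>\<omega>. h (V \<omega>) * Z l \<omega> - h (Q \<omega>) * Z l \<omega>)"
      using inthZ[OF l rv_sums(2)] inthZ[OF l Qm] z by simp
    then have "\<bar>expectation (\<lambda>\<omega>. h (V \<omega>) * Z l \<omega>)\<bar> \<le>
        expectation (\<lambda>\<omega>. \<bar>h (V \<omega>) * Z l \<omega> - h (Q \<omega>) * Z l \<omega>\<bar>)"
      by (simp only: integral_abs_bound)
    also have "\<dots> \<le> expectation (\<lambda>\<omega>. (\<lambda>x. K * (\<bar>x\<bar> * min 1 (x\<^sup>2 / n))) (Z l \<omega>))"
    proof (rule integral_mono)
      show "integrable M (\<lambda>\<omega>. \<bar>h (V \<omega>) * Z l \<omega> - h (Q \<omega>) * Z l \<omega>\<bar>)"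
        using inthZ[OF l rv_sums(2)] inthZ[OF l Qm] by auto
      show "integrable M (\<lambda>\<omega>. K * (\<bar>Z l \<omega>\<bar> * min 1 ((Z l \<omega>)\<^sup>2 / n)))"
        by (rule Bochner_Integration.integrable_bound[of _ "\<lambda>\<omega>. K * Z l \<omega>"])
          (use intZ[OF l] K_nonneg in \<open>auto simp: abs_mult intro!: AE_I2 mult_left_mono mult_left_le\<close>)
      fix \<omega>
      have "\<bar>h (V \<omega>) * Z l \<omega> - h (Q \<omega>) * Z l \<omega>\<bar> = \<bar>h (V \<omega>) - h (Q \<omega>)\<bar> * \<bar>Z l \<omega>\<bar>"
        by (simp add: abs_mult left_diff_distrib[symmetric])
      also have "\<dots> \<le> (K * min 1 \<bar>V \<omega> - Q \<omega>\<bar>) * \<bar>Z l \<omega>\<bar>"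
        by (intro mult_right_mono h_lip) auto
      finally show "\<bar>h (V \<omega>) * Z l \<omega> - h (Q \<omega>) * Z l \<omega>\<bar> \<le> (\<lambda>x. K * (\<bar>x\<bar> * min 1 (x\<^sup>2 / n))) (Z l \<omega>)"
        unfolding VQ by (simp add: mult_ac)
    qed
    also have "\<dots> = K * ?\<beta>"
      by (subst integral_observation(1)[OF _ l]) auto
    finally show ?thesis .
  qed
  have "expectation (\<lambda>\<omega>. h (V \<omega>) * S \<omega>) = expectation (\<lambda>\<omega>. (\<Sum>l\<in>B. h (V \<omega>) * Z l \<omega>) / sqrt n)"
    by (simp add: root_sum_def sum_distrib_left)
  also have "\<dots> = (\<Sum>l\<in>B. expectation (\<lambda>\<omega>. h (V \<omega>) * Z l \<omega>)) / sqrt n"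
    using inthZ[OF _ rv_sums(2)] by (simp add: Bochner_Integration.integral_sum)
  finally have "\<bar>expectation (\<lambda>\<omega>. h (V \<omega>) * S \<omega>)\<bar> = \<bar>\<Sum>l\<in>B. expectation (\<lambda>\<omega>. h (V \<omega>) * Z l \<omega>)\<bar> / sqrt n"
    by simp
  also have "\<dots> \<le> (\<Sum>l\<in>B. K * ?\<beta>) / sqrt n"
    by (intro divide_right_mono order_trans[OF sum_abs] sum_mono one) auto
  also have "\<dots> = K * sqrt n * ?\<beta>"
    using n_pos by (simp add: field_simps)
  finally show ?thesis .
qed

lemma integrable_h_root_sum:
  assumes [measurable]: "g \<in> borel_measurable M"
  shows "integrable M (\<lambda>\<omega>. h (g \<omega>) * S \<omega>)" "integrable M (\<lambda>\<omega>. (h (g \<omega>) * S \<omega>)\<^sup>2)"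
proof -
  have "(h (g \<omega>))\<^sup>2 \<le> K\<^sup>2" for \<omega>
    using power_mono[OF h_bound, of "g \<omega>" 2] by simp
  then have le: "(h (g \<omega>) * S \<omega>)\<^sup>2 \<le> K\<^sup>2 * (S \<omega>)\<^sup>2" for \<omega>
    unfolding power_mult_distrib by (intro mult_right_mono) auto
  have int: "integrable M (\<lambda>\<omega>. K\<^sup>2 * (S \<omega>)\<^sup>2)"
    using root_sum_sq(1) by (rule integrable_mult_right)
  show "integrable M (\<lambda>\<omega>. (h (g \<omega>) * S \<omega>)\<^sup>2)"
    by (rule Bochner_Integration.integrable_bound[OF int]) (use le in simp_all)
  then show "integrable M (\<lambda>\<omega>. h (g \<omega>) * S \<omega>)"
    by (rule square_integrable_imp_integrable[rotated]) measurable
qed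

text \<open>Passing from the mean square to the variance changes the argument of \<open>h\<close> by \<open>S\<^sup>2 / n\<close>. Using the bound
\<open>min 1 (y\<^sup>2) \<le> \<bar>y\<bar>\<close> for \<open>y = S / sqrt n\<close> keeps the correction within reach of the second moment of \<open>S\<close>.\<close>

lemma bias:
  "\<bar>expectation (\<lambda>\<omega>. h (v \<omega>) * S \<omega>)\<bar> \<le>
     K * sqrt n * (\<integral>x. \<bar>x\<bar> * min 1 (x\<^sup>2 / n) \<partial>\<nu>) + K * s / sqrt n"
proof -
  note int = integrable_h_root_sum(1)[OF rv_sums(2)] integrable_h_root_sum(1)[OF rv_sums(3)]
  have "expectation (\<lambda>\<omega>. h (v \<omega>) * S \<omega>) =
      expectation (\<lambda>\<omega>. h (V \<omega>) * S \<omega>) + expectation (\<lambda>\<omega>. h (v \<omega>) * S \<omega> - h (V \<omega>) * S \<omega>)"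
    using int by simp
  moreover have "\<bar>expectation (\<lambda>\<omega>. h (v \<omega>) * S \<omega> - h (V \<omega>) * S \<omega>)\<bar> \<le> K * s / sqrt n"
  proof -
    have "\<bar>expectation (\<lambda>\<omega>. h (v \<omega>) * S \<omega> - h (V \<omega>) * S \<omega>)\<bar> \<le>
        expectation (\<lambda>\<omega>. \<bar>h (v \<omega>) * S \<omega> - h (V \<omega>) * S \<omega>\<bar>)"
      by (rule integral_abs_bound)
    also have "\<dots> \<le> expectation (\<lambda>\<omega>. K / sqrt n * (S \<omega>)\<^sup>2)"
    proof (rule integral_mono)
      fix \<omega>
      have m: "min 1 (x\<^sup>2) \<le> \<bar>x\<bar>" for x :: real
        by (cases "\<bar>x\<bar> \<le> 1") (auto simp: power2_eq_square min_le_iff_disj mult_left_le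
            dest: mult_left_le[of "\<bar>x\<bar>" "\<bar>x\<bar>"])
      have "\<bar>h (v \<omega>) * S \<omega> - h (V \<omega>) * S \<omega>\<bar> = \<bar>h (v \<omega>) - h (V \<omega>)\<bar> * \<bar>S \<omega>\<bar>"
        by (simp add: abs_mult left_diff_distrib[symmetric])
      also have "\<dots> \<le> (K * min 1 \<bar>v \<omega> - V \<omega>\<bar>) * \<bar>S \<omega>\<bar>"
        by (intro mult_right_mono h_lip) auto
      also have "\<bar>v \<omega> - V \<omega>\<bar> = (S \<omega> / sqrt n)\<^sup>2"
        using n_pos by (simp add: sample_var_def power_divide)
      also have "K * min 1 ((S \<omega> / sqrt n)\<^sup>2) * \<bar>S \<omega>\<bar> \<le> K * \<bar>S \<omega> / sqrt n\<bar> * \<bar>S \<omega>\<bar>"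
        by (intro mult_right_mono mult_left_mono m K_nonneg) auto
      also have "\<dots> = K / sqrt n * (S \<omega>)\<^sup>2"
        using n_pos by (simp add: power2_eq_square)
      finally show "\<bar>h (v \<omega>) * S \<omega> - h (V \<omega>) * S \<omega>\<bar> \<le> K / sqrt n * (S \<omega>)\<^sup>2" .
    qed (use int root_sum_sq(1) in auto)
    also have "\<dots> = K / sqrt n * expectation (\<lambda>\<omega>. (S \<omega>)\<^sup>2)"
      by simp
    also have "\<dots> \<le> K / sqrt n * s"
      by (intro mult_left_mono root_sum_sq(2) divide_nonneg_nonneg K_nonneg) auto
    finally show ?thesis by simp
  qed
  ultimately show ?thesis using bias_mean_square by linarith
qed

text \<open>Split every observation into a truncated centred part \<open>f\<close> and a centred rest \<open>r\<close>. The rest has a small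
second moment and \<open>h\<close> is bounded. For the truncated sum \<open>S1\<close>, the inequality
\<open>h\<^sup>2 * S1\<^sup>2 \<le> \<eta> * S1 ^ 4 + h ^ 4 / \<eta>\<close> trades its bounded fourth moment against the smallness of \<open>h\<close>. The
error \<open>d\<close> is a parameter, because it must be made small after \<open>T\<close> and \<open>\<eta>\<close> have been chosen.\<close>

lemma weighted_second_moment:
  assumes T: "T \<ge> 0" and \<eta>: "\<eta> > 0" and d: "expectation (\<lambda>\<omega>. \<bar>v \<omega> - s\<bar>) \<le> d"
  shows "expectation (\<lambda>\<omega>. (h (v \<omega>) * S \<omega>)\<^sup>2) \<le>
    2 * K\<^sup>2 * tail_second_moment \<nu> T + 96 * \<eta> * T ^ 4 + 2 * K ^ 4 / \<eta> * d"
proof -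
  interpret nu: prob_space \<nu> by (rule prob_nu)
  \<comment> \<open>\<open>c\<close> truncates, \<open>f\<close> recentres, \<open>g = x - c x\<close> is the tail, and \<open>r\<close> is the recentred tail.\<close>
  define c where "c x = x * indicator {x. \<bar>x\<bar> \<le> T} x" for x :: real
  define m where "m = (\<integral>x. c x \<partial>\<nu>)"
  define f where "f x = c x - m" for x
  define r where "r x = x - f x" for x
  have [measurable]: "c \<in> borel_measurable borel" unfolding c_def by measurable
  have [measurable]: "f \<in> borel_measurable borel" "r \<in> borel_measurable borel"
    unfolding f_def[abs_def] r_def[abs_def] by measurable
  have cT: "\<bar>c x\<bar> \<le> T" for x using T by (auto simp: c_def indicator_def)
  have c_int: "integrable \<nu> c" by (rule nu.integrable_const_bound[where B=T]) (use cT in auto)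
  have mT: "\<bar>m\<bar> \<le> T"
  proof -
    have "\<bar>m\<bar> \<le> (\<integral>x. \<bar>c x\<bar> \<partial>\<nu>)" unfolding m_def by (rule integral_abs_bound)
    also have "\<dots> \<le> (\<integral>x. T \<partial>\<nu>)" using c_int cT by (intro integral_mono) auto
    finally show ?thesis by (simp add: nu.prob_space)
  qed
  have fT: "\<bar>f x\<bar> \<le> 2 * T" for x using cT[of x] mT unfolding f_def by linarith
  have f_int: "integrable \<nu> f" by (rule nu.integrable_const_bound[where B="2*T"]) (use fT in auto)
  have f0: "(\<integral>x. f x \<partial>\<nu>) = 0"
    using c_int by (simp add: f_def[abs_def] m_def nu.prob_space)
  have r0: "(\<integral>x. r x \<partial>\<nu>) = 0"
    using f_int integrable_nu f0 mean by (simp add: r_def[abs_def])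
  define g where "g x = x - c x" for x
  have [measurable]: "g \<in> borel_measurable borel" unfolding g_def[abs_def] by measurable
  have g_sq: "(g x)\<^sup>2 = x\<^sup>2 * indicator {x. \<bar>x\<bar> > T} x" for x
    by (auto simp: g_def c_def indicator_def)
  have g_int: "integrable \<nu> g" using integrable_nu c_int by (simp add: g_def[abs_def])
  have g_sq_int: "integrable \<nu> (\<lambda>x. (g x)\<^sup>2)" unfolding g_sq by (rule tail_second_moment_split)
  have g_mean: "(\<integral>x. g x \<partial>\<nu>) = - m"
    using integrable_nu c_int mean by (simp add: g_def[abs_def] m_def)
  have r_g: "r x = g x - (\<integral>x. g x \<partial>\<nu>)" for x unfolding g_mean by (simp add: r_def f_def g_def)
  have r_sq_int: "integrable \<nu> (\<lambda>x. (r x)\<^sup>2)"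
    using g_int g_sq_int by (simp add: r_g power2_diff)
  have r_sq: "(\<integral>x. (r x)\<^sup>2 \<partial>\<nu>) \<le> tail_second_moment \<nu> T"
    using nu.variance_eq[OF g_int g_sq_int] unfolding r_g[symmetric] by (simp add: g_sq tail_second_moment_def)
  define S1 where "S1 \<omega> = (\<Sum>l\<in>B. f (Z l \<omega>)) / sqrt n" for \<omega>
  define S2 where "S2 \<omega> = (\<Sum>l\<in>B. r (Z l \<omega>)) / sqrt n" for \<omega>
  have [measurable]: "S1 \<in> borel_measurable M" "S2 \<in> borel_measurable M"
    unfolding S1_def[abs_def] S2_def[abs_def] by measurable
  have S12: "S \<omega> = S1 \<omega> + S2 \<omega>" for \<omega>
    unfolding S1_def S2_def root_sum_def add_divide_distrib[symmetric] sum.distrib[symmetric]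
    by (simp add: r_def)
  have S2_int: "integrable M (\<lambda>\<omega>. (S2 \<omega>)\<^sup>2)" and S2_E: "expectation (\<lambda>\<omega>. (S2 \<omega>)\<^sup>2) \<le> tail_second_moment \<nu> T"
  proof -
    note sm = second_moment_sum[of r, OF _ r_sq_int r0]
    have eq: "(\<lambda>\<omega>. (S2 \<omega>)\<^sup>2) = (\<lambda>\<omega>. (\<Sum>l\<in>B. r (Z l \<omega>))\<^sup>2 / n)"
      by (simp add: S2_def power_divide)
    show "integrable M (\<lambda>\<omega>. (S2 \<omega>)\<^sup>2)" unfolding eq using sm(1) by simp
    have "expectation (\<lambda>\<omega>. (S2 \<omega>)\<^sup>2) \<le> n * (\<integral>x. (r x)\<^sup>2 \<partial>\<nu>) / n"
    proof -
      have "expectation (\<lambda>\<omega>. (\<Sum>l\<in>B. r (Z l \<omega>))\<^sup>2) / n \<le> n * (\<integral>x. (r x)\<^sup>2 \<partial>\<nu>) / n"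
        by (rule divide_right_mono[OF sm(2)]) simp_all
      then show ?thesis unfolding eq by (simp only: integral_divide_zero)
    qed
    also have "\<dots> \<le> tail_second_moment \<nu> T" using n_pos r_sq by simp
    finally show "expectation (\<lambda>\<omega>. (S2 \<omega>)\<^sup>2) \<le> tail_second_moment \<nu> T" .
  qed
  have S1_b: "\<bar>S1 \<omega>\<bar> \<le> n * (2 * T) / sqrt n" for \<omega>
  proof -
    have "\<bar>\<Sum>l\<in>B. f (Z l \<omega>)\<bar> \<le> n * (2 * T)"
      by (rule order_trans[OF sum_abs sum_bounded_above]) (rule fT)
    then show ?thesis by (simp add: S1_def divide_right_mono)
  qed
  have S1_int: "integrable M (\<lambda>\<omega>. S1 \<omega> ^ 4)"
    by (rule integrable_const_bound[where B="(n * (2 * T) / sqrt n) ^ 4"])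
      (use power_mono[OF S1_b, of _ 4] in auto)
  have S1_E: "expectation (\<lambda>\<omega>. S1 \<omega> ^ 4) \<le> 48 * T ^ 4"
  proof -
    have "expectation (\<lambda>\<omega>. (\<Sum>l\<in>B. f (Z l \<omega>)) ^ 4) \<le> 3 * n\<^sup>2 * (2 * T) ^ 4"
      by (rule expectation_pow4_sum_le[OF indep_vars_compose2[OF indep] fin])
        (use T f0 integral_observation(1)[of f] fT in auto)
    then have "expectation (\<lambda>\<omega>. S1 \<omega> ^ 4) \<le> (3 * n\<^sup>2 * (2 * T) ^ 4) / (sqrt n) ^ 4"
      by (simp add: S1_def power_divide divide_right_mono)
    also have "(sqrt n) ^ 4 = n\<^sup>2"
      using power_mult[of "sqrt n" 2 2] by simp
    also have "3 * n\<^sup>2 * (2 * T) ^ 4 / n\<^sup>2 = 48 * T ^ 4" using n_pos by (simp add: power_mult_distrib)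
    finally show ?thesis .
  qed
  note v_int = sample_var_L1(1)[OF T]
  have le: "(h (v \<omega>) * S \<omega>)\<^sup>2 \<le> 2 * K\<^sup>2 * (S2 \<omega>)\<^sup>2 + (2 * \<eta> * S1 \<omega> ^ 4 + 2 * K ^ 4 / \<eta> * \<bar>v \<omega> - s\<bar>)" for \<omega>
  proof -
    let ?h = "h (v \<omega>)"
    have h2: "?h\<^sup>2 \<le> K\<^sup>2" using power_mono[OF h_bound abs_ge_zero, of "v \<omega>" 2] by simp
    have h4: "?h ^ 4 \<le> K ^ 4 * \<bar>v \<omega> - s\<bar>"
    proof -
      have "\<bar>?h\<bar> ^ 4 \<le> (K * min 1 \<bar>v \<omega> - s\<bar>) ^ 4" by (intro power_mono h_le) auto
      also have "\<dots> = K ^ 4 * (min 1 \<bar>v \<omega> - s\<bar>) ^ 4" by (simp add: power_mult_distrib)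
      also have "(min 1 \<bar>v \<omega> - s\<bar>) ^ 4 \<le> (min 1 \<bar>v \<omega> - s\<bar>) ^ 1"
        by (rule power_decreasing) auto
      also have "\<dots> \<le> \<bar>v \<omega> - s\<bar>" by simp
      finally show ?thesis by (simp add: mult_left_mono)
    qed
    have "(S1 \<omega> + S2 \<omega>)\<^sup>2 \<le> 2 * (S1 \<omega>)\<^sup>2 + 2 * (S2 \<omega>)\<^sup>2"
      using zero_le_power2[of "S1 \<omega> - S2 \<omega>"] by (simp add: power2_eq_square algebra_simps)
    then have "(?h * S \<omega>)\<^sup>2 \<le> ?h\<^sup>2 * (2 * (S1 \<omega>)\<^sup>2 + 2 * (S2 \<omega>)\<^sup>2)"
      unfolding S12 power_mult_distrib by (rule mult_left_mono) simp
    also have "\<dots> = 2 * (?h\<^sup>2 * (S1 \<omega>)\<^sup>2) + 2 * ?h\<^sup>2 * (S2 \<omega>)\<^sup>2" by (simp add: algebra_simps)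
    also have "?h\<^sup>2 * (S1 \<omega>)\<^sup>2 \<le> \<eta> * S1 \<omega> ^ 4 + ?h ^ 4 / \<eta>"
    proof -
      have "0 \<le> (\<eta> * (S1 \<omega>)\<^sup>2 - ?h\<^sup>2)\<^sup>2" by simp
      then have "2 * \<eta> * (?h\<^sup>2 * (S1 \<omega>)\<^sup>2) \<le> \<eta>\<^sup>2 * S1 \<omega> ^ 4 + ?h ^ 4"
        by (simp add: power2_eq_square power4_eq_xxxx algebra_simps)
      moreover have "0 \<le> \<eta> * (?h\<^sup>2 * (S1 \<omega>)\<^sup>2)" using \<eta> by (intro mult_nonneg_nonneg) auto
      ultimately have "\<eta> * (?h\<^sup>2 * (S1 \<omega>)\<^sup>2) \<le> \<eta>\<^sup>2 * S1 \<omega> ^ 4 + ?h ^ 4" by linarith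
      then show ?thesis using \<eta> by (simp add: field_simps power2_eq_square)
    qed
    also have "?h ^ 4 / \<eta> \<le> K ^ 4 * \<bar>v \<omega> - s\<bar> / \<eta>"
      by (rule divide_right_mono[OF h4]) (use \<eta> in simp)
    also have "2 * ?h\<^sup>2 * (S2 \<omega>)\<^sup>2 \<le> 2 * K\<^sup>2 * (S2 \<omega>)\<^sup>2"
      by (intro mult_right_mono mult_left_mono h2) auto
    finally show ?thesis by (simp add: algebra_simps)
  qed
  have "expectation (\<lambda>\<omega>. (h (v \<omega>) * S \<omega>)\<^sup>2) \<le>
      expectation (\<lambda>\<omega>. 2 * K\<^sup>2 * (S2 \<omega>)\<^sup>2 + (2 * \<eta> * S1 \<omega> ^ 4 + 2 * K ^ 4 / \<eta> * \<bar>v \<omega> - s\<bar>))"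
    by (rule integral_mono[OF integrable_h_root_sum(2)[OF rv_sums(3)] _ le])
      (use S1_int S2_int v_int in auto)
  also have "\<dots> = 2 * K\<^sup>2 * expectation (\<lambda>\<omega>. (S2 \<omega>)\<^sup>2) +
      (2 * \<eta> * expectation (\<lambda>\<omega>. S1 \<omega> ^ 4) + 2 * K ^ 4 / \<eta> * expectation (\<lambda>\<omega>. \<bar>v \<omega> - s\<bar>))"
    using S1_int S2_int v_int by simp
  also have "\<dots> \<le> 2 * K\<^sup>2 * tail_second_moment \<nu> T + (2 * \<eta> * (48 * T ^ 4) + 2 * K ^ 4 / \<eta> * d)"
    by (intro add_mono mult_left_mono S2_E S1_E d) (use \<eta> in auto)
  finally show ?thesis by (simp add: algebra_simps)
qed

end

end

section \<open>A central limit theorem for arrays\<close>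


lemma indep_vars_PiM_coordinates:
  assumes \<nu>: "prob_space \<nu>" and sets: "sets \<nu> = sets borel"
  defines "\<Omega> \<equiv> \<Pi>\<^sub>M i\<in>(UNIV :: nat set). (\<nu> :: real measure)"
  shows "prob_space \<Omega>" and "prob_space.indep_vars \<Omega> (\<lambda>_. borel) (\<lambda>i \<omega>. \<omega> i) UNIV"
    and "distr \<Omega> borel (\<lambda>\<omega>. \<omega> i) = \<nu>"
proof -
  have c: "distr \<Omega> \<nu> (\<lambda>\<omega>. \<omega> i) = \<nu>" for i
    unfolding \<Omega>_def by (rule distr_PiM_component) (auto intro: \<nu>)
  have d: "distr \<Omega> borel (\<lambda>\<omega>. \<omega> i) = distr \<Omega> \<nu> (\<lambda>\<omega>. \<omega> i)" for i
    by (rule distr_cong) (auto simp: sets)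
  from c d show "distr \<Omega> borel (\<lambda>\<omega>. \<omega> i) = \<nu>" by simp
  show P: "prob_space \<Omega>" unfolding \<Omega>_def by (rule prob_space_PiM) (rule \<nu>)
  interpret prob_space \<Omega> by (rule P)
  have sP: "sets (\<Pi>\<^sub>M i\<in>(UNIV :: nat set). (borel :: real measure)) = sets \<Omega>"
    unfolding \<Omega>_def by (rule sets_PiM_cong) (auto simp: sets)
  show "indep_vars (\<lambda>_. borel) (\<lambda>i \<omega>. \<omega> i) UNIV"
  proof (subst indep_vars_iff_distr_eq_PiM')
    show "distr \<Omega> (\<Pi>\<^sub>M i\<in>UNIV. borel) (\<lambda>x. \<lambda>i\<in>UNIV. x i) =
        (\<Pi>\<^sub>M i\<in>UNIV. distr \<Omega> borel (\<lambda>\<omega>. \<omega> i))"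
      unfolding d c using distr_id2[OF sP] by (simp add: \<Omega>_def restrict_def)
    show "random_variable borel (\<lambda>\<omega>. \<omega> i)" for i
      unfolding \<Omega>_def using measurable_component_singleton[of i UNIV "\<lambda>_. \<nu>"]
      by (simp add: measurable_cong_sets[OF refl sets])
  qed simp
qed

text \<open>The central limit theorem in a form that mentions only the law \<open>\<nu>\<close>. An array has a different
probability space in every row, so the theorem is applied to the coordinates of the infinite product of
\<open>\<nu>\<close> and carried over through characteristic functions.\<close>

lemma char_power_tendsto:
  fixes \<nu> :: "real measure"
  assumes \<nu>: "prob_space \<nu>" and sets: "sets \<nu> = sets borel"
    and sq: "integrable \<nu> (\<lambda>x. x\<^sup>2)" and mean: "(\<integral>x. x \<partial>\<nu>) = 0"
    and second: "(\<integral>x. x\<^sup>2 \<partial>\<nu>) = \<sigma>\<^sup>2" and \<sigma>: "\<sigma> > 0"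
  shows "(\<lambda>n. char \<nu> (t / sqrt (real n)) ^ n) \<longlonglongrightarrow> exp (- (\<sigma> * t)\<^sup>2 / 2)"
proof -
  define \<Omega> where "\<Omega> = (\<Pi>\<^sub>M i\<in>(UNIV :: nat set). \<nu>)"
  note co = indep_vars_PiM_coordinates[OF \<nu> sets, folded \<Omega>_def]
  interpret prob_space \<Omega> by (rule co(1))
  have [measurable]: "(\<lambda>\<omega>. \<omega> i) \<in> borel_measurable \<Omega>" for i
    using co(2) unfolding indep_vars_def2 by auto
  have m: "expectation (\<lambda>\<omega>. f (\<omega> i) :: real) = (\<integral>x. f x \<partial>\<nu>)"
    "integrable \<Omega> (\<lambda>\<omega>. f (\<omega> i)) \<longleftrightarrow> integrable \<nu> f" if [measurable]: "f \<in> borel_measurable borel" for f i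
    using integral_distr[of "\<lambda>\<omega>. \<omega> i" \<Omega> borel f] integrable_distr_eq[of "\<lambda>\<omega>. \<omega> i" \<Omega> borel f]
    by (simp_all add: co(3))
  have clt: "weak_conv_m (\<lambda>n. distr \<Omega> borel (\<lambda>\<omega>. (\<Sum>i<n. \<omega> i) / sqrt (n * \<sigma>\<^sup>2))) std_normal_distribution"
  proof (rule central_limit_theorem_zero_mean[OF co(2) _ \<sigma> _ _ co(3)])
    show m0: "expectation (\<lambda>\<omega>. \<omega> i) = 0" for i using m(1)[of "\<lambda>x. x" i] mean by simp
    show "integrable \<Omega> (\<lambda>\<omega>. (\<omega> i)\<^sup>2)" for i using m(2)[of "\<lambda>x. x\<^sup>2" i] sq by simp
    show "variance (\<lambda>\<omega>. \<omega> i) = \<sigma>\<^sup>2" for i using m0[of i] m(1)[of "\<lambda>x. x\<^sup>2" i] second by simp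
  qed
  have eq: "char (distr \<Omega> borel (\<lambda>\<omega>. (\<Sum>i<n. \<omega> i) / sqrt (n * \<sigma>\<^sup>2))) (\<sigma> * t) = char \<nu> (t / sqrt (real n)) ^ n" for n
  proof -
    have "char (distr \<Omega> borel (\<lambda>\<omega>. (\<Sum>i<n. \<omega> i) / sqrt (n * \<sigma>\<^sup>2))) (\<sigma> * t) =
        char (distr \<Omega> borel (\<lambda>\<omega>. \<Sum>i<n. \<omega> i)) (t / sqrt n)"
      using \<sigma> by (simp add: char_def integral_distr real_sqrt_mult)
    also have "\<dots> = (\<Prod>i<n. char (distr \<Omega> borel (\<lambda>\<omega>. \<omega> i)) (t / sqrt n))"
      by (rule char_distr_sum[OF indep_vars_subset[OF co(2)]]) simp
    finally show ?thesis by (simp add: co(3))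
  qed
  have "(\<lambda>n. char (distr \<Omega> borel (\<lambda>\<omega>. (\<Sum>i<n. \<omega> i) / sqrt (n * \<sigma>\<^sup>2))) (\<sigma> * t))
      \<longlonglongrightarrow> char std_normal_distribution (\<sigma> * t)"
    by (rule levy_continuity1[OF _ real_dist_normal_dist clt]) simp
  then show ?thesis
    unfolding eq char_std_normal_distribution by simp
qed

lemma char_normal_distribution:
  assumes \<sigma>: "\<sigma> > 0"
  shows "real_distribution (density lborel (\<lambda>x. ennreal (normal_density 0 \<sigma> x)))"
    and "char (density lborel (\<lambda>x. ennreal (normal_density 0 \<sigma> x))) t = exp (- (\<sigma> * t)\<^sup>2 / 2)"
proof -
  let ?N = "std_normal_distribution"
  interpret N: real_distribution ?N by (rule real_dist_normal_dist)
  have "distributed ?N lborel (\<lambda>x. x) (normal_density 0 1)"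
    unfolding distributed_def by (auto simp: distr_id2)
  from N.normal_density_affine[OF this, of \<sigma> 0] \<sigma>
  have "distributed ?N lborel (\<lambda>x. \<sigma> * x) (normal_density 0 \<sigma>)"
    by simp
  then have eq: "density lborel (\<lambda>x. ennreal (normal_density 0 \<sigma> x)) = distr ?N borel (\<lambda>x. \<sigma> * x)"
    unfolding distributed_def using distr_cong[OF refl sets_lborel, of ?N "\<lambda>x. \<sigma> * x"] by simp
  show "real_distribution (density lborel (\<lambda>x. ennreal (normal_density 0 \<sigma> x)))"
    unfolding eq by (rule N.real_distribution_distr) simp
  have "char (distr ?N borel (\<lambda>x. \<sigma> * x)) t = char ?N (\<sigma> * t)"
    by (simp add: char_def integral_distr mult_ac)
  then show "char (density lborel (\<lambda>x. ennreal (normal_density 0 \<sigma> x))) t = exp (- (\<sigma> * t)\<^sup>2 / 2)"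
    unfolding eq by (simp add: char_std_normal_distribution)
qed

text \<open>Slutsky's lemma on changing probability spaces: characteristic functions of variables that differ by
at most \<open>\<epsilon>\<close> outside an event of probability \<open>q\<close> differ by at most \<open>\<bar>t\<bar> * \<epsilon> + 2 * q\<close>, and convergence of
characteristic functions is weak convergence by Levy's theorem.\<close>

lemma weak_conv_m_perturb:
  fixes M :: "nat \<Rightarrow> 'b measure" and R W :: "nat \<Rightarrow> 'b \<Rightarrow> real"
  assumes M: "\<And>j. prob_space (M j)"
    and R[measurable]: "\<And>j. R j \<in> borel_measurable (M j)"
    and W[measurable]: "\<And>j. W j \<in> borel_measurable (M j)"
    and \<mu>: "real_distribution \<mu>"
    and char: "\<And>t. (\<lambda>j. char (distr (M j) borel (R j)) t) \<longlonglongrightarrow> char \<mu> t"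
    and close: "\<And>\<epsilon>. \<epsilon> > 0 \<Longrightarrow>
      (\<lambda>j. measure (M j) {\<omega> \<in> space (M j). \<bar>W j \<omega> - R j \<omega>\<bar> > \<epsilon>}) \<longlonglongrightarrow> 0"
  shows "weak_conv_m (\<lambda>j. distr (M j) borel (W j)) \<mu>"
proof (rule levy_continuity[OF _ \<mu>])
  show "real_distribution (distr (M j) borel (W j))" for j
    using prob_space.real_distribution_distr[OF M W] .
  fix t :: real
  let ?P = "\<lambda>\<epsilon> j. measure (M j) {\<omega> \<in> space (M j). \<bar>W j \<omega> - R j \<omega>\<bar> > \<epsilon>}"
  have bound: "cmod (char (distr (M j) borel (W j)) t - char (distr (M j) borel (R j)) t) \<le>
      \<bar>t\<bar> * \<epsilon> + 2 * ?P \<epsilon> j" if \<epsilon>: "\<epsilon> > 0" for \<epsilon> j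
  proof -
    interpret prob_space "M j" by (rule M)
    let ?A = "{\<omega> \<in> space (M j). \<bar>W j \<omega> - R j \<omega>\<bar> > \<epsilon>}"
    have int: "integrable (M j) (\<lambda>\<omega>. iexp (t * W j \<omega>))" "integrable (M j) (\<lambda>\<omega>. iexp (t * R j \<omega>))"
      by (auto intro!: integrable_iexp)
    have A: "?A \<in> events" by measurable
    have ind: "integrable (M j) (indicator ?A :: _ \<Rightarrow> real)"
      by (rule integrable_real_indicator[OF A]) (simp add: emeasure_eq_measure)
    have "char (distr (M j) borel (W j)) t - char (distr (M j) borel (R j)) t =
        (CLINT \<omega>|M j. iexp (t * W j \<omega>) - iexp (t * R j \<omega>))"
      using int by (simp add: char_def integral_distr)
    then have "cmod (char (distr (M j) borel (W j)) t - char (distr (M j) borel (R j)) t) \<le>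
        expectation (\<lambda>\<omega>. cmod (iexp (t * W j \<omega>) - iexp (t * R j \<omega>)))"
      by (simp only: integral_norm_bound)
    also have "\<dots> \<le> expectation (\<lambda>\<omega>. \<bar>t\<bar> * \<epsilon> + 2 * indicator ?A \<omega>)"
    proof (rule integral_mono)
      fix \<omega> assume "\<omega> \<in> space (M j)"
      have 2: "cmod (iexp (t * W j \<omega>) - iexp (t * R j \<omega>)) \<le> 2"
        by (rule order_trans[OF norm_triangle_ineq4]) simp
      have "iexp (t * W j \<omega>) - iexp (t * R j \<omega>) = iexp (t * R j \<omega>) * (iexp (t * (W j \<omega> - R j \<omega>)) - 1)"
        by (simp add: right_diff_distrib flip: exp_add)
      then have "cmod (iexp (t * W j \<omega>) - iexp (t * R j \<omega>)) = cmod (iexp (t * (W j \<omega> - R j \<omega>)) - 1)"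
        by (simp add: norm_mult)
      also have "\<dots> \<le> \<bar>t * (W j \<omega> - R j \<omega>)\<bar>"
        using iexp_approx1[of "t * (W j \<omega> - R j \<omega>)" 0] by simp
      finally have 1: "cmod (iexp (t * W j \<omega>) - iexp (t * R j \<omega>)) \<le> \<bar>t\<bar> * \<bar>W j \<omega> - R j \<omega>\<bar>"
        by (simp add: abs_mult)
      show "cmod (iexp (t * W j \<omega>) - iexp (t * R j \<omega>)) \<le> \<bar>t\<bar> * \<epsilon> + 2 * indicator ?A \<omega>"
      proof (cases "\<omega> \<in> ?A")
        case True
        have "0 \<le> \<bar>t\<bar> * \<epsilon>" using \<epsilon> by simp
        with 2 True show ?thesis by (simp add: indicator_def)
      next
        case False
        then have "\<bar>W j \<omega> - R j \<omega>\<bar> \<le> \<epsilon>" using \<open>\<omega> \<in> space (M j)\<close> by auto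
        then have "\<bar>t\<bar> * \<bar>W j \<omega> - R j \<omega>\<bar> \<le> \<bar>t\<bar> * \<epsilon>" by (rule mult_left_mono) simp
        with 1 have "cmod (iexp (t * W j \<omega>) - iexp (t * R j \<omega>)) \<le> \<bar>t\<bar> * \<epsilon>" by (rule order_trans)
        then show ?thesis by (simp add: indicator_simps(2)[OF False])
      qed
    next
      show "integrable (M j) (\<lambda>\<omega>. cmod (iexp (t * W j \<omega>) - iexp (t * R j \<omega>)))"
        using int by (intro integrable_norm Bochner_Integration.integrable_diff)
      show "integrable (M j) (\<lambda>\<omega>. \<bar>t\<bar> * \<epsilon> + 2 * indicator ?A \<omega>)"
        using ind by (intro Bochner_Integration.integrable_add integrable_mult_right) simp_all
    qed
    also have "\<dots> = \<bar>t\<bar> * \<epsilon> + 2 * ?P \<epsilon> j"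
      using ind A by (subst Bochner_Integration.integral_add) (simp_all add: prob_space)
    finally show ?thesis .
  qed
  have "(\<lambda>j. char (distr (M j) borel (W j)) t - char (distr (M j) borel (R j)) t) \<longlonglongrightarrow> 0"
  proof (rule LIMSEQ_I)
    fix r :: real assume r: "r > 0"
    define \<epsilon> where "\<epsilon> = r / (2 * (\<bar>t\<bar> + 1))"
    have \<epsilon>: "\<epsilon> > 0" using r by (simp add: \<epsilon>_def)
    have "\<bar>t\<bar> * \<epsilon> \<le> (\<bar>t\<bar> + 1) * \<epsilon>" using \<epsilon> by simp
    also have "\<dots> = r / 2" by (simp add: \<epsilon>_def) (simp add: field_simps)
    finally have t: "\<bar>t\<bar> * \<epsilon> \<le> r / 2" .
    from LIMSEQ_D[OF close[OF \<epsilon>], of "r / 8"] r obtain J where J: "\<And>j. j \<ge> J \<Longrightarrow> ?P \<epsilon> j < r / 8"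
      by auto
    show "\<exists>J. \<forall>j\<ge>J. cmod (char (distr (M j) borel (W j)) t - char (distr (M j) borel (R j)) t - 0) < r"
    proof (intro exI[of _ J] allI impI)
      fix j assume "j \<ge> J"
      from J[OF this] bound[OF \<epsilon>, of j] t r
      show "cmod (char (distr (M j) borel (W j)) t - char (distr (M j) borel (R j)) t - 0) < r"
        by simp
    qed
  qed
  from tendsto_add[OF this char[of t]]
  show "(\<lambda>j. char (distr (M j) borel (W j)) t) \<longlonglongrightarrow> char \<mu> t" by simp
qed

section \<open>The weights and the normalised error\<close>


text \<open>The relative excess of the weight \<open>v powr (-p / 2)\<close> of a block with variance \<open>v\<close> over \<open>s powr (-p / 2)\<close>.
The floor \<open>s / 4\<close> removes the singularity at zero and is inactive when all block variances exceed \<open>s / 4\<close>.\<close>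

definition weight_defect :: "real \<Rightarrow> real \<Rightarrow> real \<Rightarrow> real" where
  "weight_defect s p v = (s / max v (s / 4)) powr (p / 2) - 1"

lemma weight_defect_measurable [measurable]: "weight_defect s p \<in> borel_measurable borel"
  unfolding weight_defect_def[abs_def] by measurable

lemma weight_defect_self: "s > 0 \<Longrightarrow> weight_defect s p s = 0"
  by (simp add: weight_defect_def max_def)

lemma weight_defect_lipschitz:
  assumes s: "s > 0" and p: "p > 0"
  shows "\<exists>K. \<forall>u w. \<bar>weight_defect s p u - weight_defect s p w\<bar> \<le> K * min 1 \<bar>u - w\<bar>"
proof -
  define q where "q = p / 2"
  define f where "f x = s powr q * x powr (- q)" for x
  define L where "L = s powr q * (q * (s / 4) powr (- q - 1))"
  have q: "q > 0" using p by (simp add: q_def)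
  have wd: "weight_defect s p v = f (max v (s / 4)) - 1" for v
  proof -
    have "(s / max v (s / 4)) powr q = s powr q / max v (s / 4) powr q"
      by (rule powr_divide)
    then show ?thesis
      by (simp only: weight_defect_def f_def q_def[symmetric] powr_minus_divide times_divide_eq_right mult_1_right)
  qed
  have step: "\<bar>f b - f a\<bar> \<le> L * (b - a)" if a: "s / 4 \<le> a" and ab: "a < b" for a b
  proof -
    have "\<exists>z. a < z \<and> z < b \<and> f b - f a = (b - a) * (s powr q * (- q * z powr (- q - 1)))"
    proof (rule MVT2[OF ab])
      fix x assume "a \<le> x"
      then have "x > 0" using a s by linarith
      then show "DERIV f x :> s powr q * (- q * x powr (- q - 1))"
        unfolding f_def by (auto intro!: derivative_eq_intros)
    qed
    then obtain z where z: "a < z" "f b - f a = (b - a) * (s powr q * (- q * z powr (- q - 1)))" by auto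
    have "z powr (- q - 1) \<le> (s / 4) powr (- q - 1)"
      using z a s q by (intro powr_mono2') auto
    then have "s powr q * (q * z powr (- q - 1)) \<le> L"
      unfolding L_def using q by (intro mult_left_mono) auto
    then have "(b - a) * (s powr q * (q * z powr (- q - 1))) \<le> (b - a) * L"
      using ab by (intro mult_left_mono) auto
    moreover have "\<bar>f b - f a\<bar> = (b - a) * (s powr q * (q * z powr (- q - 1)))"
      unfolding z(2) using ab q by (simp add: abs_mult)
    ultimately show ?thesis by (simp add: mult.commute)
  qed
  have L0: "L \<ge> 0" unfolding L_def using q by auto
  have lip: "\<bar>f a - f b\<bar> \<le> L * \<bar>a - b\<bar>" if "s / 4 \<le> a" "s / 4 \<le> b" for a b
    using step[of a b] step[of b a] that by (cases a b rule: linorder_cases) (auto simp: abs_minus_commute)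
  define C where "C = f (s / 4)"
  have range: "0 \<le> f x" "f x \<le> C" if "s / 4 \<le> x" for x
    using that s q unfolding f_def C_def by (auto intro!: mult_left_mono powr_mono2')
  show ?thesis
  proof (intro exI allI)
    fix u w :: real
    let ?u = "max u (s / 4)" and ?w = "max w (s / 4)"
    have "\<bar>f ?u - f ?w\<bar> \<le> L * \<bar>?u - ?w\<bar>" by (rule lip) auto
    also have "\<dots> \<le> L * \<bar>u - w\<bar>" using L0 by (intro mult_left_mono) auto
    also have "\<dots> \<le> (L + C) * \<bar>u - w\<bar>" using range[of "s / 4"] by (intro mult_right_mono) auto
    finally have 1: "\<bar>f ?u - f ?w\<bar> \<le> (L + C) * \<bar>u - w\<bar>" .
    have 2: "\<bar>f ?u - f ?w\<bar> \<le> (L + C) * 1"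
      using range[of ?u] range[of ?w] L0 by auto
    from 1 2 show "\<bar>weight_defect s p u - weight_defect s p w\<bar> \<le> (L + C) * min 1 \<bar>u - w\<bar>"
      by (simp add: wd min_def)
  qed
qed

lemma block_sd_eq:
  assumes "card B = m" "m > 0"
  shows "block_mean m B y - \<mu> = root_sum B (\<lambda>l. y l - \<mu>) / sqrt m"
    and "block_sd m B y = sqrt (sample_var B (\<lambda>l. y l - \<mu>))"
proof -
  have fin: "finite B" using assms card_gt_0_iff by fastforce
  have mp: "real m > 0" using assms by simp
  show 1: "block_mean m B y - \<mu> = root_sum B (\<lambda>l. y l - \<mu>) / sqrt m"
    using assms mp by (simp add: block_mean_def root_sum_def sum_subtractf field_simps)
  define a where "a = block_mean m B y - \<mu>"
  define z where "z l = y l - \<mu>" for l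
  have sa: "(\<Sum>l\<in>B. z l) = real m * a"
    using assms mp by (simp add: a_def z_def block_mean_def sum_subtractf field_simps)
  have "(\<Sum>l\<in>B. (y l - block_mean m B y)\<^sup>2) = (\<Sum>l\<in>B. (z l)\<^sup>2 - 2 * a * z l + a\<^sup>2)"
    by (rule sum.cong) (auto simp: a_def z_def power2_eq_square algebra_simps)
  also have "\<dots> = (\<Sum>l\<in>B. (z l)\<^sup>2) - real m * a\<^sup>2"
    using assms by (simp add: sum.distrib sum_subtractf sum_distrib_left[symmetric] sa power2_eq_square)
  finally have 2: "(\<Sum>l\<in>B. (y l - block_mean m B y)\<^sup>2) = (\<Sum>l\<in>B. (y l - \<mu>)\<^sup>2) - real m * a\<^sup>2"
    by (simp only: z_def)
  have "root_sum B (\<lambda>l. y l - \<mu>) = sqrt m * a"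
    unfolding a_def 1 using mp by simp
  then have "(root_sum B (\<lambda>l. y l - \<mu>))\<^sup>2 = real m * a\<^sup>2"
    by (simp add: power_mult_distrib)
  then show "block_sd m B y = sqrt (sample_var B (\<lambda>l. y l - \<mu>))"
    using assms mp by (simp add: block_sd_def 2 sample_var_def mean_square_def field_simps)
qed

text \<open>The common factor \<open>s powr (-p / 2)\<close> of the weights cancels, and the blocks enter with equal size, so the
part of the weighted sum that does not involve the defects is the sum over all observations.\<close>

lemma weighted_block_mean_decomposition:
  fixes y :: "nat \<Rightarrow> real" and \<mu> s p :: real and k m :: nat and G :: "nat \<Rightarrow> nat set"
  defines "z \<equiv> \<lambda>l. y l - \<mu>"
  defines "H \<equiv> (\<Sum>i\<in>{1..k}. weight_defect s p (sample_var (G i) z)) / real k"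
  defines "T \<equiv> (\<Sum>i\<in>{1..k}. weight_defect s p (sample_var (G i) z) * root_sum (G i) z) / sqrt k"
  assumes part: "block_partition k m G" and k: "k > 0" and m: "m > 0" and s: "s > 0"
    and v: "\<And>i. i \<in> {1..k} \<Longrightarrow> sample_var (G i) z > s / 4"
  shows "sqrt (k * m) * (weighted_block_mean d p k m G y - \<mu>) * (1 + H) = root_sum {1..k * m} z + T"
proof -
  let ?h = "\<lambda>i. weight_defect s p (sample_var (G i) z)"
  let ?S = "\<lambda>i. root_sum (G i) z"
  have card: "card (G i) = m" if "i \<in> {1..k}" for i using part that by (auto simp: block_partition_def)
  have fin: "finite (G i)" if "i \<in> {1..k}" for i
    using card[OF that] m card_gt_0_iff by fastforce
  note bs = block_sd_eq[OF card m, of _ y \<mu>, folded z_def]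
  define c where "c = s powr (- (p / 2))"
  define w where "w i = 1 / block_sd m (G i) y powr p" for i
  have c: "c > 0" using s by (simp add: c_def)
  have w_eq: "w i = c * (1 + ?h i)" if i: "i \<in> {1..k}" for i
  proof -
    have vp: "sample_var (G i) z > 0" using v[OF i] s by simp
    have "w i = sample_var (G i) z powr (- (p / 2))"
      unfolding w_def bs(2)[OF i] using vp
      by (simp add: powr_half_sqrt[symmetric] powr_powr powr_minus_divide)
    also have "\<dots> = c * (s / sample_var (G i) z) powr (p / 2)"
      using vp s by (simp add: c_def powr_divide powr_minus field_simps)
    finally show ?thesis using v[OF i] by (simp add: weight_defect_def max_def)
  qed
  have w_pos: "w i > 0" if i: "i \<in> {1..k}" for i
    unfolding w_def bs(2)[OF i] using v[OF i] s by simp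
  have W: "(\<Sum>i\<in>{1..k}. w i) > 0" by (rule sum_pos) (use k w_pos in auto)
  have W_eq: "(\<Sum>i\<in>{1..k}. w i) = c * k * (1 + H)"
    using k w_eq by (simp add: H_def sum.distrib sum_distrib_left[symmetric] field_simps)
  have sd: "\<forall>i\<in>{1..k}. block_sd m (G i) y > 0"
    using bs(2) v s by (metis divide_pos_pos less_trans real_sqrt_gt_0_iff zero_less_numeral)
  have "(weighted_block_mean d p k m G y - \<mu>) * (\<Sum>i\<in>{1..k}. w i) =
      (\<Sum>i\<in>{1..k}. w i * block_mean m (G i) y) - \<mu> * (\<Sum>i\<in>{1..k}. w i)"
    using sd W unfolding weighted_block_mean_def block_weight_def w_def[symmetric]
    by (simp add: sum_divide_distrib[symmetric] left_diff_distrib)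
  also have "\<dots> = (\<Sum>i\<in>{1..k}. w i * (block_mean m (G i) y - \<mu>))"
    by (simp add: right_diff_distrib sum_subtractf sum_distrib_left mult.commute)
  also have "\<dots> = (\<Sum>i\<in>{1..k}. c * (1 + ?h i) * (?S i / sqrt m))"
    by (rule sum.cong) (simp_all only: w_eq bs(1))
  also have "\<dots> = c / sqrt m * (\<Sum>i\<in>{1..k}. (1 + ?h i) * ?S i)"
    by (simp add: sum_distrib_left mult_ac)
  also have "(\<Sum>i\<in>{1..k}. (1 + ?h i) * ?S i) = (\<Sum>i\<in>{1..k}. ?S i) + sqrt k * T"
    using k by (simp add: T_def distrib_right sum.distrib)
  also have "(\<Sum>i\<in>{1..k}. ?S i) = sqrt k * root_sum {1..k * m} z"
  proof -
    have "(\<Sum>l\<in>{1..k * m}. z l) = (\<Sum>l\<in>(\<Union>i\<in>{1..k}. G i). z l)"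
      using part by (simp add: block_partition_def)
    also have "\<dots> = (\<Sum>i\<in>{1..k}. \<Sum>l\<in>G i. z l)"
      using part fin by (intro sum.UNION_disjoint) (auto simp: block_partition_def disjoint_family_on_def)
    also have "\<dots> = sqrt m * (\<Sum>i\<in>{1..k}. ?S i)"
      using m card by (simp add: root_sum_def sum_divide_distrib[symmetric])
    finally show ?thesis using k m by (simp add: root_sum_def real_sqrt_mult)
  qed
  finally have "(weighted_block_mean d p k m G y - \<mu>) * (c * k * (1 + H)) =
      c / sqrt m * (sqrt k * root_sum {1..k * m} z + sqrt k * T)"
    unfolding W_eq .
  then have "c * (real k * ((weighted_block_mean d p k m G y - \<mu>) * (1 + H))) =
      c * (sqrt k / sqrt m * (root_sum {1..k * m} z + T))"
    by (simp add: algebra_simps)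
  then have eq: "real k * ((weighted_block_mean d p k m G y - \<mu>) * (1 + H)) =
      sqrt k / sqrt m * (root_sum {1..k * m} z + T)"
    by (rule mult_left_cancel[THEN iffD1, OF less_imp_neq[OF c, symmetric]])
  have "sqrt (k * m) * (weighted_block_mean d p k m G y - \<mu>) * (1 + H) =
      sqrt m / sqrt k * (real k * ((weighted_block_mean d p k m G y - \<mu>) * (1 + H)))"
  proof -
    have "real k / sqrt k = sqrt k" by (rule real_div_sqrt) simp
    then have "sqrt m / sqrt k * (real k * a) = sqrt k * sqrt m * a" for a
      by (metis mult.assoc mult.commute times_divide_eq_right)
    then show ?thesis by (simp add: real_sqrt_mult)
  qed
  also have "\<dots> = root_sum {1..k * m} z + T"
    unfolding eq using k m by simp
  finally show ?thesis .
qed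


section \<open>The rate function\<close>


lemma min_one_le_powr:
  assumes "0 \<le> y" "0 \<le> a" "a \<le> (1::real)" shows "min 1 y \<le> y powr a"
proof (cases "y = 0 \<or> y \<ge> 1")
  case True
  then show ?thesis using assms by (auto simp: ge_one_powr_ge_zero)
next
  case False
  then show ?thesis using assms powr_mono'[of a 1 y] by auto
qed

text \<open>Below the threshold \<open>r powr (1/4)\<close> use \<open>min 1 y \<le> y\<close> and \<open>\<bar>x\<bar> ^ 3 \<le> \<bar>x\<bar> powr (1 + \<delta>) * r powr ((2 - \<delta>) / 4)\<close>;
above it use \<open>min 1 y \<le> y powr (\<delta> / 2)\<close>, where \<open>y = x\<^sup>2 / r\<close>. The two terms correspond to the two
entries of the maximum in \<open>\<phi>\<close>.\<close>

lemma abs_min_square_le: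
  fixes x \<delta> r :: real
  assumes \<delta>: "1 \<le> \<delta>" "\<delta> \<le> 2" and r: "r > 0"
  shows "\<bar>x\<bar> * min 1 (x\<^sup>2 / r) \<le> r powr ((2 - \<delta>) / 4 - 1) * \<bar>x\<bar> powr (1 + \<delta>)
    + r powr (- \<delta> / 2) * (\<bar>x\<bar> powr (1 + \<delta>) * indicator {x. \<bar>x - 0\<bar> \<ge> r powr (1 / 4)} x)"
proof (cases "x = 0")
  case False
  then have x: "\<bar>x\<bar> > 0" by simp
  show ?thesis
  proof (cases "\<bar>x\<bar> \<ge> r powr (1 / 4)")
    case True
    have sq: "x\<^sup>2 powr (\<delta> / 2) = \<bar>x\<bar> powr \<delta>"
    proof -
      have "x\<^sup>2 = \<bar>x\<bar> powr 2" using x by (simp add: powr_numeral)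
      then show ?thesis by (simp only: powr_powr) simp
    qed
    have "min 1 (x\<^sup>2 / r) \<le> (x\<^sup>2 / r) powr (\<delta> / 2)"
      using \<delta> r by (intro min_one_le_powr) auto
    also have "\<dots> = \<bar>x\<bar> powr \<delta> * r powr (- \<delta> / 2)"
      using powr_minus_divide[of r "\<delta> / 2"] r by (simp add: powr_divide sq)
    finally have "\<bar>x\<bar> * min 1 (x\<^sup>2 / r) \<le> \<bar>x\<bar> * (\<bar>x\<bar> powr \<delta> * r powr (- \<delta> / 2))"
      by (rule mult_left_mono) simp
    also have "\<dots> = r powr (- \<delta> / 2) * \<bar>x\<bar> powr (1 + \<delta>)"
      using x by (simp add: powr_add)
    also have "\<dots> \<le> r powr ((2 - \<delta>) / 4 - 1) * \<bar>x\<bar> powr (1 + \<delta>) + r powr (- \<delta> / 2) * \<bar>x\<bar> powr (1 + \<delta>)"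
      by simp
    finally show ?thesis using True by simp
  next
    case False
    have "\<bar>x\<bar> * min 1 (x\<^sup>2 / r) \<le> \<bar>x\<bar> * (x\<^sup>2 / r)" by (intro mult_left_mono) auto
    also have "\<dots> = \<bar>x\<bar> powr (1 + \<delta>) * \<bar>x\<bar> powr (2 - \<delta>) / r"
      using x by (simp add: powr_add[symmetric] power2_eq_square powr_numeral power3_eq_cube flip: abs_mult)
    also have "\<dots> \<le> \<bar>x\<bar> powr (1 + \<delta>) * (r powr (1 / 4)) powr (2 - \<delta>) / r"
      using False x \<delta> r by (intro divide_right_mono mult_left_mono powr_mono2) auto
    also have "\<dots> = r powr ((2 - \<delta>) / 4 - 1) * \<bar>x\<bar> powr (1 + \<delta>)"
    proof -
      have "(r powr (1 / 4)) powr (2 - \<delta>) = r powr ((2 - \<delta>) / 4)"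
        by (simp only: powr_powr) simp
      moreover have "r powr ((2 - \<delta>) / 4 - 1) = r powr ((2 - \<delta>) / 4) / r"
        using powr_diff[of r "(2 - \<delta>) / 4" 1] r by simp
      ultimately show ?thesis by (simp only: mult.commute times_divide_eq_right)
    qed
    finally show ?thesis using False by simp
  qed
qed simp

text \<open>The tail part of the bias is bounded by \<open>g\<close> itself, whereas \<open>\<phi>\<close> contains the power of \<open>g\<close> with an exponent
in \<open>[0, 1]\<close>. As \<open>g \<le> A\<close>, that power dominates \<open>g\<close> up to the factor \<open>1 + A\<close>.\<close>

lemma bias_integral_le_phi:
  fixes \<nu> :: "real measure"
  assumes sets [measurable_cong]: "sets \<nu> = sets borel" 
    and \<delta>: "1 \<le> \<delta>" "\<delta> \<le> 2" and int: "integrable \<nu> (\<lambda>x. \<bar>x\<bar> powr (1 + \<delta>))" and n: "n > 0"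
  defines "A \<equiv> \<integral>x. \<bar>x\<bar> powr (1 + \<delta>) \<partial>\<nu>"
  shows "sqrt n * (\<integral>x. \<bar>x\<bar> * min 1 (x\<^sup>2 / n) \<partial>\<nu>) \<le> (1 + 2 * A) * (sqrt n * phi \<nu> (\<lambda>x. x) 0 \<delta> n)"
proof -
  define r where "r = real n"
  define g where "g = tail_moment \<nu> (\<lambda>x. x) 0 \<delta> (r powr (1 / 4))"
  define q where "q = (2 - \<delta>) / (2 + \<delta>)"
  have r: "r > 0" using n by (simp add: r_def)
  have q: "0 \<le> q" "q \<le> 1" using \<delta> by (auto simp: q_def field_simps)
  have A: "A \<ge> 0" unfolding A_def by simp
  have g_int: "integrable \<nu> (\<lambda>x. \<bar>x\<bar> powr (1 + \<delta>) * indicator {x. \<bar>x - 0\<bar> \<ge> r powr (1 / 4)} x)"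
    by (rule Bochner_Integration.integrable_bound[OF int]) (auto simp: indicator_def)
  have g: "0 \<le> g" "g \<le> A"
    unfolding g_def tail_moment_def A_def using g_int int
    by (auto intro!: integral_mono Bochner_Integration.integral_nonneg simp: indicator_def)
  have gq: "g \<le> (1 + A) * powr_one g q"
  proof (cases "q = 0 \<or> g = 0")
    case True then show ?thesis using g by (auto simp: powr_one_def)
  next
    case False
    then have g0: "g > 0" and q0: "q > 0" using g q by auto
    show ?thesis
    proof (cases "g \<le> 1")
      case True
      have "g \<le> g powr q" using powr_mono'[of q 1 g] q g0 True by simp
      also have "\<dots> \<le> (1 + A) * g powr q" using A by (simp add: distrib_right)
      finally show ?thesis using False by (simp add: powr_one_def)
    next
      case gt: False
      then have "1 \<le> g powr q" using q by (intro ge_one_powr_ge_zero) auto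
      then have "1 * A \<le> (1 + A) * g powr q" using A
        by (subst mult.commute, intro mult_mono) auto
      with g show ?thesis using False by (simp add: powr_one_def)
    qed
  qed
  have phi_eq: "phi \<nu> (\<lambda>x. x) 0 \<delta> n =
      r powr (- \<delta> / 2) * max (r powr (- ((2 - \<delta>) / 4))) (powr_one g q)"
    by (simp only: phi_def r_def g_def q_def)
  have "(\<integral>x. \<bar>x\<bar> * min 1 (x\<^sup>2 / r) \<partial>\<nu>) \<le> (\<integral>x. r powr ((2 - \<delta>) / 4 - 1) * \<bar>x\<bar> powr (1 + \<delta>)
    + r powr (- \<delta> / 2) * (\<bar>x\<bar> powr (1 + \<delta>) * indicator {x. \<bar>x - 0\<bar> \<ge> r powr (1 / 4)} x) \<partial>\<nu>)"
    using int g_int abs_min_square_le[OF \<delta> r] by (intro integral_mono') auto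
  also have "\<dots> = r powr ((2 - \<delta>) / 4 - 1) * A + r powr (- \<delta> / 2) * g"
    using int g_int by (simp add: A_def g_def tail_moment_def)
  also have "r powr ((2 - \<delta>) / 4 - 1) * A = r powr (- \<delta> / 2) * (A * r powr (- ((2 - \<delta>) / 4)))"
    using r by (simp add: powr_add[symmetric] field_simps)
  also have "r powr (- \<delta> / 2) * (A * r powr (- ((2 - \<delta>) / 4))) + r powr (- \<delta> / 2) * g
     \<le> r powr (- \<delta> / 2) * (A * max (r powr (- ((2 - \<delta>) / 4))) (powr_one g q)) +
        r powr (- \<delta> / 2) * ((1 + A) * max (r powr (- ((2 - \<delta>) / 4))) (powr_one g q))"
    using A by (intro add_mono mult_left_mono order_trans[OF gq]) auto
  also have "\<dots> = (1 + 2 * A) * phi \<nu> (\<lambda>x. x) 0 \<delta> n"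
    by (simp add: phi_eq algebra_simps)
  finally have "sqrt r * (\<integral>x. \<bar>x\<bar> * min 1 (x\<^sup>2 / r) \<partial>\<nu>) \<le> sqrt r * ((1 + 2 * A) * phi \<nu> (\<lambda>x. x) 0 \<delta> n)"
    by (rule mult_left_mono) (use r in simp)
  then show ?thesis by (simp add: r_def mult_ac)
qed

text \<open>The first entry of the maximum alone gives \<open>\<phi> \<delta> n \<ge> n powr (-1/2 - \<delta>/4) \<ge> 1 / n\<close>. This makes
the correction terms of order \<open>1 / sqrt n\<close> harmless and forces \<open>k / n\<close> to vanish.\<close>

lemma inverse_sqrt_le_phi:
  assumes \<delta>: "\<delta> \<le> 2" and n: "n > 0"
  shows "1 / sqrt n \<le> sqrt n * phi P X \<mu> \<delta> n"
proof -
  define r where "r = real n"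
  have r: "r \<ge> 1" using n by (simp add: r_def)
  have "1 / sqrt r = r powr (- (1 / 2))" using powr_minus_divide[of r "1 / 2"] r by (simp add: powr_half_sqrt)
  also have "\<dots> \<le> r powr (1 / 2 + (- \<delta> / 2 + (- ((2 - \<delta>) / 4))))"
    using r \<delta> by (intro powr_mono) (auto simp: field_simps)
  also have "\<dots> = sqrt r * (r powr (- \<delta> / 2) * r powr (- ((2 - \<delta>) / 4)))"
    using r by (simp only: powr_add powr_half_sqrt)
  also have "\<dots> \<le> sqrt r * phi P X \<mu> \<delta> n"
    unfolding phi_def r_def by (intro mult_left_mono) auto
  finally show ?thesis by (simp add: r_def)
qed

lemma tail_second_moment_tendsto_0:
  assumes sets [measurable_cong]: "sets \<nu> = sets borel" and sq: "integrable \<nu> (\<lambda>x. x\<^sup>2)"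
  shows "(tail_second_moment \<nu> \<longlongrightarrow> 0) at_top"
proof -
  have "((\<lambda>T. \<integral>x. x\<^sup>2 * indicator {x. \<bar>x\<bar> > T} x \<partial>\<nu>) \<longlongrightarrow> (\<integral>x. 0 \<partial>\<nu>)) at_top"
  proof (rule integral_dominated_convergence_at_top[where w="\<lambda>x. x\<^sup>2"])
    show "AE x in \<nu>. ((\<lambda>T. x\<^sup>2 * indicator {x. \<bar>x\<bar> > T} x) \<longlongrightarrow> (0::real)) at_top"
    proof (rule AE_I2)
      fix x :: real
      have "eventually (\<lambda>T. x\<^sup>2 * indicator {x. \<bar>x\<bar> > T} x = (0::real)) at_top"
        using eventually_ge_at_top[of "\<bar>x\<bar>"] by eventually_elim (simp add: indicator_def)
      then show "((\<lambda>T. x\<^sup>2 * indicator {x. \<bar>x\<bar> > T} x) \<longlongrightarrow> (0::real)) at_top"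
        by (rule tendsto_eventually)
    qed
    show "\<forall>\<^sub>F T in at_top. AE x in \<nu>. norm (x\<^sup>2 * indicator {x. \<bar>x\<bar> > T} x :: real) \<le> x\<^sup>2"
      by (intro always_eventually allI AE_I2) (auto simp: indicator_def)
  qed (use sq in \<open>auto\<close>)
  then show ?thesis by (simp add: tail_second_moment_def[abs_def])
qed

section \<open>One row of the array\<close>


lemma sample_var_cong: "(\<And>l. l \<in> B \<Longrightarrow> y l = z l) \<Longrightarrow> sample_var B y = sample_var B z"
  and root_sum_cong: "(\<And>l. l \<in> B \<Longrightarrow> y l = z l) \<Longrightarrow> root_sum B y = root_sum B z"
  by (simp_all add: sample_var_def root_sum_def mean_square_def cong: sum.cong)

text \<open>One row of the array. For \<open>h = weight_defect s p\<close> the variables \<open>R\<close>, \<open>H\<close> and \<open>T\<close> below are those of the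
identity \<open>W * (1 + H) = R + T\<close> for the normalised error \<open>W\<close>.\<close>

locale block_array = prob_space M for M :: "'b measure" +
  fixes Z :: "nat \<Rightarrow> 'b \<Rightarrow> real" and k m :: nat and G :: "nat \<Rightarrow> nat set"
    and \<nu> :: "real measure" and s :: real and h :: "real \<Rightarrow> real" and K :: real
  assumes k_pos: "k > 0" and m_pos: "m > 0" and part: "block_partition k m G"
    and indep: "indep_vars (\<lambda>_. borel) Z {1..k * m}"
    and distr: "\<And>l. l \<in> {1..k * m} \<Longrightarrow> distr M borel (Z l) = \<nu>"
    and sq: "integrable \<nu> (\<lambda>x. x\<^sup>2)" and mean: "(\<integral>x. x \<partial>\<nu>) = 0"
    and second: "(\<integral>x. x\<^sup>2 \<partial>\<nu>) = s" and s_pos: "s > 0"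
    and h_meas [measurable]: "h \<in> borel_measurable borel"
    and h_lip: "\<And>u w. \<bar>h u - h w\<bar> \<le> K * min 1 \<bar>u - w\<bar>" and h_s: "h s = 0"
begin

abbreviation "v i \<omega> \<equiv> sample_var (G i) (\<lambda>l. Z l \<omega>)"
abbreviation "S i \<omega> \<equiv> root_sum (G i) (\<lambda>l. Z l \<omega>)"
abbreviation "R \<omega> \<equiv> root_sum {1..k * m} (\<lambda>l. Z l \<omega>)"

definition H :: "'b \<Rightarrow> real" where
  "H \<omega> = (\<Sum>i\<in>{1..k}. h (v i \<omega>)) / real k"

definition T :: "'b \<Rightarrow> real" where
  "T \<omega> = (\<Sum>i\<in>{1..k}. h (v i \<omega>) * S i \<omega>) / sqrt (real k)"

lemma card_block: "i \<in> {1..k} \<Longrightarrow> card (G i) = m"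
  and block_subset: "i \<in> {1..k} \<Longrightarrow> G i \<subseteq> {1..k * m}"
  using part by (auto simp: block_partition_def)

lemma block: "i \<in> {1..k} \<Longrightarrow> iid_block M Z (G i) \<nu> s"
proof unfold_locales
  assume i: "i \<in> {1..k}"
  show "finite (G i)" using block_subset[OF i] finite_subset by blast
  show "G i \<noteq> {}" using card_block[OF i] m_pos by auto
  show "indep_vars (\<lambda>_. borel) Z (G i)" using indep block_subset[OF i] by (rule indep_vars_subset)
  show "distr M borel (Z l) = \<nu>" if "l \<in> G i" for l using that block_subset[OF i] distr by blast
qed (simp_all add: sq mean second)

lemma whole: "iid_block M Z {1..k * m} \<nu> s"
  by unfold_locales (use k_pos m_pos indep distr sq mean second in auto)

lemma rv_block [measurable]:
  "i \<in> {1..k} \<Longrightarrow> v i \<in> borel_measurable M" "i \<in> {1..k} \<Longrightarrow> S i \<in> borel_measurable M"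
  using iid_block.rv_sums[OF block] by auto

lemma rv_R [measurable]: "R \<in> borel_measurable M"
  using iid_block.rv_sums(1)[OF whole] .

lemma rv_HT [measurable]: "H \<in> borel_measurable M" "T \<in> borel_measurable M"
  unfolding H_def[abs_def] T_def[abs_def] by measurable

text \<open>The summands are functions of disjoint groups of independent observations, hence independent. After
division by \<open>sqrt k\<close> the fluctuation of one block survives once, and its squared bias \<open>k\<close> times.\<close>

lemma T_second_moment:
  assumes e: "\<And>i. i \<in> {1..k} \<Longrightarrow> expectation (\<lambda>\<omega>. (h (v i \<omega>) * S i \<omega>)\<^sup>2) \<le> e"
    and b: "\<And>i. i \<in> {1..k} \<Longrightarrow> \<bar>expectation (\<lambda>\<omega>. h (v i \<omega>) * S i \<omega>)\<bar> \<le> b"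
  shows "integrable M (\<lambda>\<omega>. (T \<omega>)\<^sup>2)" and "expectation (\<lambda>\<omega>. (T \<omega>)\<^sup>2) \<le> e + real k * b\<^sup>2"
proof -
  let ?A = "\<lambda>i z. h (sample_var (G i) z) * root_sum (G i) z"
  have "indep_vars (\<lambda>j. PiM (G j) (\<lambda>_. borel)) (\<lambda>j \<omega>. restrict (\<lambda>i. Z i \<omega>) (G j)) {1..k}"
    by (rule indep_vars_restrict[OF indep block_subset]) (use part in \<open>auto simp: block_partition_def\<close>)
  then have "indep_vars (\<lambda>_. borel) (\<lambda>j \<omega>. ?A j (restrict (\<lambda>i. Z i \<omega>) (G j))) {1..k}"
    by (rule indep_vars_compose2) (unfold sample_var_def root_sum_def mean_square_def, measurable)
  also have "(\<lambda>j \<omega>. ?A j (restrict (\<lambda>i. Z i \<omega>) (G j))) = (\<lambda>j \<omega>. h (v j \<omega>) * S j \<omega>)"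
    by (intro ext arg_cong2[where f="(*)"] arg_cong[where f=h] sample_var_cong root_sum_cong) auto
  finally have ind: "indep_vars (\<lambda>_. borel) (\<lambda>j \<omega>. h (v j \<omega>) * S j \<omega>) {1..k}" .
  have int: "integrable M (\<lambda>\<omega>. (h (v i \<omega>) * S i \<omega>)\<^sup>2)" if i: "i \<in> {1..k}" for i
    by (rule iid_block.integrable_h_root_sum(2)[OF block[OF i] h_meas h_lip h_s]) (use i in measurable)
  have eq: "(\<lambda>\<omega>. (T \<omega>)\<^sup>2) = (\<lambda>\<omega>. (\<Sum>i\<in>{1..k}. h (v i \<omega>) * S i \<omega>)\<^sup>2 / real k)"
    by (simp add: T_def power_divide)
  note A = expectation_sq_sum_le[OF ind _ int e b]
  show "integrable M (\<lambda>\<omega>. (T \<omega>)\<^sup>2)" unfolding eq using A(1) by simp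
  have "expectation (\<lambda>\<omega>. (T \<omega>)\<^sup>2) = expectation (\<lambda>\<omega>. (\<Sum>i\<in>{1..k}. h (v i \<omega>) * S i \<omega>)\<^sup>2) / real k"
    unfolding eq by simp
  also have "\<dots> \<le> (real k * e + (real k * b)\<^sup>2) / real k"
    using A(2) by (intro divide_right_mono) auto
  also have "\<dots> = e + real k * b\<^sup>2"
    using k_pos by (simp add: add_divide_distrib power2_eq_square)
  finally show "expectation (\<lambda>\<omega>. (T \<omega>)\<^sup>2) \<le> e + real k * b\<^sup>2" .
qed

lemma H_L1:
  assumes d: "\<And>i. i \<in> {1..k} \<Longrightarrow> expectation (\<lambda>\<omega>. \<bar>v i \<omega> - s\<bar>) \<le> d"
  shows "integrable M (\<lambda>\<omega>. \<bar>H \<omega>\<bar>)" and "expectation (\<lambda>\<omega>. \<bar>H \<omega>\<bar>) \<le> K * d"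
proof -
  note K0 = iid_block.K_nonneg[OF whole h_meas h_lip h_s]
    and hK = iid_block.h_bound[OF whole h_meas h_lip h_s]
  have h: "\<bar>h u\<bar> \<le> K * \<bar>u - s\<bar>" for u
    by (rule order_trans[OF iid_block.h_le[OF whole h_meas h_lip h_s]]) (simp add: mult_left_mono K0)
  have hi: "integrable M (\<lambda>\<omega>. \<bar>h (v i \<omega>)\<bar>)" if i: "i \<in> {1..k}" for i
    by (rule integrable_const_bound[where B=K]) (use i hK in \<open>auto\<close>)
  have hE: "expectation (\<lambda>\<omega>. \<bar>h (v i \<omega>)\<bar>) \<le> K * d" if i: "i \<in> {1..k}" for i
  proof -
    note vi = iid_block.sample_var_L1(1)[OF block[OF i], of 0]
    have "expectation (\<lambda>\<omega>. \<bar>h (v i \<omega>)\<bar>) \<le> expectation (\<lambda>\<omega>. K * \<bar>v i \<omega> - s\<bar>)"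
      by (rule integral_mono[OF hi[OF i]]) (use vi h in auto)
    also have "\<dots> = K * expectation (\<lambda>\<omega>. \<bar>v i \<omega> - s\<bar>)" by simp
    also have "\<dots> \<le> K * d" by (intro mult_left_mono d[OF i] K0)
    finally show ?thesis .
  qed
  have sum_int: "integrable M (\<lambda>\<omega>. (\<Sum>i\<in>{1..k}. \<bar>h (v i \<omega>)\<bar>) / real k)"
    by (intro integrable_divide_zero Bochner_Integration.integrable_sum hi)
  have le: "\<bar>H \<omega>\<bar> \<le> (\<Sum>i\<in>{1..k}. \<bar>h (v i \<omega>)\<bar>) / real k" for \<omega>
    by (simp add: H_def divide_right_mono)
  show int: "integrable M (\<lambda>\<omega>. \<bar>H \<omega>\<bar>)"
    by (rule Bochner_Integration.integrable_bound[OF sum_int])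
      (use order_trans[OF le abs_ge_self] in \<open>simp_all add: rv_HT\<close>)
  have "expectation (\<lambda>\<omega>. \<bar>H \<omega>\<bar>) \<le> expectation (\<lambda>\<omega>. (\<Sum>i\<in>{1..k}. \<bar>h (v i \<omega>)\<bar>) / real k)"
    by (rule integral_mono[OF int sum_int le])
  also have "\<dots> = (\<Sum>i\<in>{1..k}. expectation (\<lambda>\<omega>. \<bar>h (v i \<omega>)\<bar>)) / real k"
    using hi by (simp add: Bochner_Integration.integral_sum)
  also have "\<dots> \<le> (\<Sum>i\<in>{1..k}. K * d) / real k"
    by (intro divide_right_mono sum_mono hE) auto
  also have "\<dots> = K * d" using k_pos by simp
  finally show "expectation (\<lambda>\<omega>. \<bar>H \<omega>\<bar>) \<le> K * d" .
qed

text \<open>Since \<open>W * (1 + H) = R + T\<close>, also \<open>(W - R) * (1 + H) = T - R * H\<close>. If \<open>\<bar>H\<bar> < \<eta> \<le> 1 / 2\<close>, then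
\<open>\<bar>W - R\<bar> \<le> 2 * \<bar>T\<bar> + 2 * \<eta> * \<bar>R\<bar>\<close>, so \<open>W\<close> can be far from \<open>R\<close> only if some block has a small variance, or
\<open>\<bar>H\<bar> \<ge> \<eta>\<close>, or \<open>\<bar>T\<bar> \<ge> \<epsilon> / 4\<close>, or \<open>\<bar>R\<bar> \<ge> \<epsilon> / (4 * \<eta>)\<close>. The four terms come from the union bound over
the blocks and from Markov's inequality for \<open>\<bar>H\<bar>\<close>, \<open>T\<^sup>2\<close> and \<open>R\<^sup>2\<close>.\<close>

lemma prob_far_le:
  assumes c: "\<And>i. i \<in> {1..k} \<Longrightarrow> prob {\<omega> \<in> space M. v i \<omega> \<le> s / 4} \<le> c"
    and d: "\<And>i. i \<in> {1..k} \<Longrightarrow> expectation (\<lambda>\<omega>. \<bar>v i \<omega> - s\<bar>) \<le> d"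
    and e: "\<And>i. i \<in> {1..k} \<Longrightarrow> expectation (\<lambda>\<omega>. (h (v i \<omega>) * S i \<omega>)\<^sup>2) \<le> e"
    and b: "\<And>i. i \<in> {1..k} \<Longrightarrow> \<bar>expectation (\<lambda>\<omega>. h (v i \<omega>) * S i \<omega>)\<bar> \<le> b"
    and W [measurable]: "W \<in> borel_measurable M"
    and WT: "\<And>\<omega>. \<omega> \<in> space M \<Longrightarrow> (\<And>i. i \<in> {1..k} \<Longrightarrow> v i \<omega> > s / 4) \<Longrightarrow> W \<omega> * (1 + H \<omega>) = R \<omega> + T \<omega>"
    and \<eta>: "0 < \<eta>" "\<eta> \<le> 1 / 2" and \<epsilon>: "\<epsilon> > 0"
  shows "prob {\<omega> \<in> space M. \<bar>W \<omega> - R \<omega>\<bar> > \<epsilon>} \<le>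
    real k * c + K * d / \<eta> + 16 * (e + real k * b\<^sup>2) / \<epsilon>\<^sup>2 + 16 * \<eta>\<^sup>2 * s / \<epsilon>\<^sup>2"
proof -
  let ?E1 = "\<Union>i\<in>{1..k}. {\<omega> \<in> space M. v i \<omega> \<le> s / 4}"
  let ?E2 = "{\<omega> \<in> space M. \<bar>H \<omega>\<bar> \<ge> \<eta>}"
  let ?E3 = "{\<omega> \<in> space M. (T \<omega>)\<^sup>2 \<ge> \<epsilon>\<^sup>2 / 16}"
  let ?E4 = "{\<omega> \<in> space M. (R \<omega>)\<^sup>2 \<ge> \<epsilon>\<^sup>2 / (16 * \<eta>\<^sup>2)}"
  have E1: "?E1 \<in> events" by (intro sets.finite_UN) (auto intro!: borel_measurable_le)
  have E2: "?E2 \<in> events" and E3: "?E3 \<in> events" and E4: "?E4 \<in> events" by measurable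
  have "{\<omega> \<in> space M. \<bar>W \<omega> - R \<omega>\<bar> > \<epsilon>} \<subseteq> ?E1 \<union> ?E2 \<union> ?E3 \<union> ?E4"
  proof
    fix \<omega> assume "\<omega> \<in> {\<omega> \<in> space M. \<bar>W \<omega> - R \<omega>\<bar> > \<epsilon>}"
    then have w: "\<omega> \<in> space M" and far: "\<bar>W \<omega> - R \<omega>\<bar> > \<epsilon>" by auto
    show "\<omega> \<in> ?E1 \<union> ?E2 \<union> ?E3 \<union> ?E4"
    proof (rule ccontr)
      assume n: "\<omega> \<notin> ?E1 \<union> ?E2 \<union> ?E3 \<union> ?E4"
      have "W \<omega> * (1 + H \<omega>) = R \<omega> + T \<omega>" by (rule WT[OF w]) (use n w in force)
      then have eq: "(W \<omega> - R \<omega>) * (1 + H \<omega>) = T \<omega> - R \<omega> * H \<omega>"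
        by (simp add: algebra_simps)
      have H: "\<bar>H \<omega>\<bar> < \<eta>" using n w by auto
      have "(T \<omega>)\<^sup>2 < (\<epsilon> / 4)\<^sup>2" using n w by (auto simp: power_divide)
      then have "\<bar>T \<omega>\<bar>\<^sup>2 < (\<epsilon> / 4)\<^sup>2" by simp
      then have T: "\<bar>T \<omega>\<bar> < \<epsilon> / 4" by (rule power_less_imp_less_base) (use \<epsilon> in simp)
      have "(R \<omega>)\<^sup>2 < (\<epsilon> / (4 * \<eta>))\<^sup>2" using n w by (auto simp: power_divide power_mult_distrib)
      then have "\<bar>R \<omega>\<bar>\<^sup>2 < (\<epsilon> / (4 * \<eta>))\<^sup>2" by simp
      then have "\<bar>R \<omega>\<bar> < \<epsilon> / (4 * \<eta>)" by (rule power_less_imp_less_base) (use \<epsilon> \<eta> in simp)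
      then have R: "\<bar>R \<omega>\<bar> * \<eta> \<le> \<epsilon> / 4" using \<eta> by (simp add: field_simps)
      have "\<bar>R \<omega> * H \<omega>\<bar> \<le> \<bar>R \<omega>\<bar> * \<eta>"
        unfolding abs_mult using H by (intro mult_left_mono) auto
      then have "\<bar>T \<omega> - R \<omega> * H \<omega>\<bar> < \<epsilon> / 2" using T R by linarith
      moreover have "\<bar>W \<omega> - R \<omega>\<bar> * (1 / 2) \<le> \<bar>W \<omega> - R \<omega>\<bar> * \<bar>1 + H \<omega>\<bar>"
        using H \<eta> by (intro mult_left_mono) auto
      then have "\<bar>W \<omega> - R \<omega>\<bar> * (1 / 2) \<le> \<bar>T \<omega> - R \<omega> * H \<omega>\<bar>"
        unfolding abs_mult[symmetric] eq .
      ultimately have "\<bar>W \<omega> - R \<omega>\<bar> * (1 / 2) < \<epsilon> / 2" by (rule le_less_trans[rotated])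
      then show False using far by simp
    qed
  qed
  then have "prob {\<omega> \<in> space M. \<bar>W \<omega> - R \<omega>\<bar> > \<epsilon>} \<le> prob (?E1 \<union> ?E2 \<union> ?E3 \<union> ?E4)"
    by (rule finite_measure_mono) (use E1 E2 E3 E4 in blast)
  also have "\<dots> \<le> prob (?E1 \<union> ?E2 \<union> ?E3) + prob ?E4"
    by (rule measure_Un_le) (use E1 E2 E3 E4 in blast)+
  also have "prob (?E1 \<union> ?E2 \<union> ?E3) \<le> prob (?E1 \<union> ?E2) + prob ?E3"
    by (rule measure_Un_le) (use E1 E2 E3 in blast)+
  also have "prob (?E1 \<union> ?E2) \<le> prob ?E1 + prob ?E2"
    by (rule measure_Un_le) (use E1 E2 in blast)+
  also have "prob ?E1 \<le> (\<Sum>i\<in>{1..k}. prob {\<omega> \<in> space M. v i \<omega> \<le> s / 4})"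
    by (rule finite_measure_subadditive_finite) (auto intro!: borel_measurable_le)
  also have "\<dots> \<le> (\<Sum>i\<in>{1..k}. c)" by (rule sum_mono) (rule c)
  also have "\<dots> = real k * c" by simp
  also have "prob ?E2 \<le> expectation (\<lambda>\<omega>. \<bar>H \<omega>\<bar>) / \<eta>"
    by (rule integral_Markov_inequality_measure[OF H_L1(1)[OF d], of "space M"]) (use \<eta> in auto)
  also have "\<dots> \<le> K * d / \<eta>"
    by (rule divide_right_mono[OF H_L1(2)[OF d]]) (use \<eta> in auto)
  also have "prob ?E3 \<le> expectation (\<lambda>\<omega>. (T \<omega>)\<^sup>2) / (\<epsilon>\<^sup>2 / 16)"
    by (rule integral_Markov_inequality_measure[OF T_second_moment(1)[OF e b], of "space M"]) (use \<epsilon> in auto)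
  also have "\<dots> \<le> (e + real k * b\<^sup>2) / (\<epsilon>\<^sup>2 / 16)"
    by (rule divide_right_mono[OF T_second_moment(2)[OF e b]]) (use \<epsilon> in auto)
  also have "prob ?E4 \<le> expectation (\<lambda>\<omega>. (R \<omega>)\<^sup>2) / (\<epsilon>\<^sup>2 / (16 * \<eta>\<^sup>2))"
    by (rule integral_Markov_inequality_measure[OF iid_block.root_sum_sq(1)[OF whole], of "space M"]) (use \<epsilon> \<eta> in auto)
  also have "\<dots> \<le> s / (\<epsilon>\<^sup>2 / (16 * \<eta>\<^sup>2))"
    by (rule divide_right_mono[OF iid_block.root_sum_sq(2)[OF whole]]) simp
  finally show ?thesis by (simp add: mult_ac)
qed

lemma prob_far_explicit:
  fixes T0 T1 T2 \<eta>1 b :: real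
  assumes T: "T0 \<ge> 0" "T1 \<ge> 0" "T2 \<ge> 0" and T0: "tail_second_moment \<nu> T0 \<le> s / 4" and \<eta>1: "\<eta>1 > 0"
    and W: "W \<in> borel_measurable M"
    and WT: "\<And>\<omega>. \<omega> \<in> space M \<Longrightarrow> (\<And>i. i \<in> {1..k} \<Longrightarrow> v i \<omega> > s / 4) \<Longrightarrow> W \<omega> * (1 + H \<omega>) = R \<omega> + T \<omega>"
    and \<eta>: "0 < \<eta>" "\<eta> \<le> 1 / 2" and \<epsilon>: "\<epsilon> > 0"
  defines "d \<equiv> 2 * tail_second_moment \<nu> T2 + T2\<^sup>2 / sqrt m + s / m"
  assumes b: "K * sqrt m * (\<integral>x. \<bar>x\<bar> * min 1 (x\<^sup>2 / m) \<partial>\<nu>) + K * s / sqrt m \<le> b"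
  shows "prob {\<omega> \<in> space M. \<bar>W \<omega> - R \<omega>\<bar> > \<epsilon>} \<le>
    real k * ((16 * T0 ^ 4 / s\<^sup>2 + 4) / m) + K * d / \<eta> +
    16 * (2 * K\<^sup>2 * tail_second_moment \<nu> T1 + 96 * \<eta>1 * T1 ^ 4 + 2 * K ^ 4 / \<eta>1 * d + real k * b\<^sup>2) / \<epsilon>\<^sup>2
    + 16 * \<eta>\<^sup>2 * s / \<epsilon>\<^sup>2"
proof -
  have d: "expectation (\<lambda>\<omega>. \<bar>v i \<omega> - s\<bar>) \<le> d" if i: "i \<in> {1..k}" for i
    using iid_block.sample_var_L1(2)[OF block[OF i] T(3)] by (simp add: d_def card_block[OF i])
  show ?thesis
  proof (rule prob_far_le[OF _ d _ _ W WT \<eta> \<epsilon>])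
    fix i assume i: "i \<in> {1..k}"
    note bl = block[OF i] and c = card_block[OF i]
    show "prob {\<omega> \<in> space M. v i \<omega> \<le> s / 4} \<le> (16 * T0 ^ 4 / s\<^sup>2 + 4) / m"
      using iid_block.prob_sample_var_small[OF bl T(1) T0 s_pos] by (simp add: c)
    show "expectation (\<lambda>\<omega>. (h (v i \<omega>) * S i \<omega>)\<^sup>2) \<le>
        2 * K\<^sup>2 * tail_second_moment \<nu> T1 + 96 * \<eta>1 * T1 ^ 4 + 2 * K ^ 4 / \<eta>1 * d"
      by (rule iid_block.weighted_second_moment[OF bl h_meas h_lip h_s T(2) \<eta>1 d[OF i]])
    show "\<bar>expectation (\<lambda>\<omega>. h (v i \<omega>) * S i \<omega>)\<bar> \<le> b"
      using order_trans[OF iid_block.bias[OF bl h_meas h_lip h_s, unfolded c] b] .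
  qed
qed

end

section \<open>The limit\<close>


text \<open>The order of the choices matters: \<open>\<eta>\<close> first, then the truncation level \<open>T1\<close>, then \<open>\<eta>1\<close> depending on \<open>T1\<close>,
and finally \<open>T2\<close>, which must beat the constants \<open>1 / \<eta>\<close> and \<open>1 / \<eta>1\<close>. Each choice makes one term of the
limit of the bound smaller than \<open>\<rho> / 4\<close>.\<close>

lemma explicit_bound_vanishes:
  fixes k m :: "nat \<Rightarrow> nat" and p b :: "nat \<Rightarrow> real" and \<tau> :: "real \<Rightarrow> real" and s K \<epsilon> T0 :: real
  assumes \<tau>: "(\<tau> \<longlongrightarrow> 0) at_top" and m: "filterlim m at_top sequentially"
    and km: "(\<lambda>j. real (k j) / real (m j)) \<longlonglongrightarrow> 0" and kb: "(\<lambda>j. real (k j) * (b j)\<^sup>2) \<longlonglongrightarrow> 0"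
    and \<epsilon>: "\<epsilon> > 0" and nonneg: "\<And>j. 0 \<le> p j"
    and bound: "\<And>T1 T2 \<eta>1 \<eta>. T1 \<ge> 0 \<Longrightarrow> T2 \<ge> 0 \<Longrightarrow> \<eta>1 > 0 \<Longrightarrow> 0 < \<eta> \<Longrightarrow> \<eta> \<le> 1 / 2 \<Longrightarrow>
      eventually (\<lambda>j. p j \<le> real (k j) * ((16 * T0 ^ 4 / s\<^sup>2 + 4) / real (m j)) +
        K * (2 * \<tau> T2 + T2\<^sup>2 / sqrt (real (m j)) + s / real (m j)) / \<eta> +
        16 * (2 * K\<^sup>2 * \<tau> T1 + 96 * \<eta>1 * T1 ^ 4 +
          2 * K ^ 4 / \<eta>1 * (2 * \<tau> T2 + T2\<^sup>2 / sqrt (real (m j)) + s / real (m j)) +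
          real (k j) * (b j)\<^sup>2) / \<epsilon>\<^sup>2 + 16 * \<eta>\<^sup>2 * s / \<epsilon>\<^sup>2) sequentially"
  shows "p \<longlonglongrightarrow> 0"
proof (rule order_tendstoI)
  show "eventually (\<lambda>j. a < p j) sequentially" if "a < 0" for a
    by (intro always_eventually allI less_le_trans[OF that nonneg])
  fix \<rho> :: real assume \<rho>: "0 < \<rho>"
  have "((\<lambda>\<eta>. 16 * \<eta>\<^sup>2 * s / \<epsilon>\<^sup>2) \<longlongrightarrow> 16 * 0\<^sup>2 * s / \<epsilon>\<^sup>2) (at_right 0)"
    using \<epsilon> by (intro tendsto_intros) auto
  then have "eventually (\<lambda>\<eta>. 16 * \<eta>\<^sup>2 * s / \<epsilon>\<^sup>2 < \<rho> / 4) (at_right 0)"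
    by (rule order_tendstoD) (use \<rho> in simp)
  moreover have "eventually (\<lambda>\<eta>::real. 0 < \<eta> \<and> \<eta> < 1 / 2) (at_right 0)"
    unfolding eventually_at_right_field by (intro exI[of _ "1 / 2"]) auto
  ultimately have "eventually (\<lambda>\<eta>. 16 * \<eta>\<^sup>2 * s / \<epsilon>\<^sup>2 < \<rho> / 4 \<and> 0 < \<eta> \<and> \<eta> < 1 / 2) (at_right 0)"
    by eventually_elim auto
  then obtain \<eta> where \<eta>: "16 * \<eta>\<^sup>2 * s / \<epsilon>\<^sup>2 < \<rho> / 4" "0 < \<eta>" "\<eta> < 1 / 2"
    using eventually_happens[of _ "at_right (0::real)"] by auto
  have "((\<lambda>T. 16 * (2 * K\<^sup>2 * \<tau> T) / \<epsilon>\<^sup>2) \<longlongrightarrow> 16 * (2 * K\<^sup>2 * 0) / \<epsilon>\<^sup>2) at_top"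
    using \<epsilon> by (intro tendsto_intros \<tau>) auto
  then have "eventually (\<lambda>T. 16 * (2 * K\<^sup>2 * \<tau> T) / \<epsilon>\<^sup>2 < \<rho> / 4) at_top"
    by (rule order_tendstoD) (use \<rho> in simp)
  from eventually_conj[OF this eventually_ge_at_top[of 0]]
  obtain T1 where T1: "16 * (2 * K\<^sup>2 * \<tau> T1) / \<epsilon>\<^sup>2 < \<rho> / 4" "T1 \<ge> 0"
    using eventually_happens[of _ "at_top :: real filter"] by auto
  have "((\<lambda>\<eta>. 16 * (96 * \<eta> * T1 ^ 4) / \<epsilon>\<^sup>2) \<longlongrightarrow> 16 * (96 * 0 * T1 ^ 4) / \<epsilon>\<^sup>2) (at_right 0)"
    using \<epsilon> by (intro tendsto_intros) auto
  then have "eventually (\<lambda>\<eta>. 16 * (96 * \<eta> * T1 ^ 4) / \<epsilon>\<^sup>2 < \<rho> / 4) (at_right 0)"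
    by (rule order_tendstoD) (use \<rho> in simp)
  from eventually_conj[OF this eventually_at_right_less]
  obtain \<eta>1 where \<eta>1: "16 * (96 * \<eta>1 * T1 ^ 4) / \<epsilon>\<^sup>2 < \<rho> / 4" "\<eta>1 > 0"
    using eventually_happens[of _ "at_right (0::real)"] by auto
  \<comment> \<open>the total factor in front of \<open>2 * \<tau> T2 + T2\<^sup>2 / sqrt m + s / m\<close>\<close>
  define a where "a = K / \<eta> + 32 * K ^ 4 / (\<eta>1 * \<epsilon>\<^sup>2)"
  have "((\<lambda>T. a * (2 * \<tau> T)) \<longlongrightarrow> a * (2 * 0)) at_top"
    by (intro tendsto_intros \<tau>)
  then have "eventually (\<lambda>T. a * (2 * \<tau> T) < \<rho> / 4) at_top"
    by (rule order_tendstoD) (use \<rho> in simp)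
  from eventually_conj[OF this eventually_ge_at_top[of 0]]
  obtain T2 where T2: "a * (2 * \<tau> T2) < \<rho> / 4" "T2 \<ge> 0"
    using eventually_happens[of _ "at_top :: real filter"] by auto
  define U where "U j = real (k j) * ((16 * T0 ^ 4 / s\<^sup>2 + 4) / real (m j)) +
        K * (2 * \<tau> T2 + T2\<^sup>2 / sqrt (real (m j)) + s / real (m j)) / \<eta> +
        16 * (2 * K\<^sup>2 * \<tau> T1 + 96 * \<eta>1 * T1 ^ 4 +
          2 * K ^ 4 / \<eta>1 * (2 * \<tau> T2 + T2\<^sup>2 / sqrt (real (m j)) + s / real (m j)) +
          real (k j) * (b j)\<^sup>2) / \<epsilon>\<^sup>2 + 16 * \<eta>\<^sup>2 * s / \<epsilon>\<^sup>2" for j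
  define V where "V = a * (2 * \<tau> T2) + 16 * (2 * K\<^sup>2 * \<tau> T1) / \<epsilon>\<^sup>2 +
    16 * (96 * \<eta>1 * T1 ^ 4) / \<epsilon>\<^sup>2 + 16 * \<eta>\<^sup>2 * s / \<epsilon>\<^sup>2"
  have rm: "filterlim (\<lambda>j. real (m j)) at_top sequentially"
    by (rule filterlim_compose[OF filterlim_real_sequentially m])
  have l1: "(\<lambda>j. T2\<^sup>2 / sqrt (real (m j))) \<longlonglongrightarrow> 0"
    by (intro tendsto_divide_0[OF tendsto_const] filterlim_at_top_imp_at_infinity
        filterlim_compose[OF sqrt_at_top rm])
  have l2: "(\<lambda>j. s / real (m j)) \<longlonglongrightarrow> 0"
    by (intro tendsto_divide_0[OF tendsto_const] filterlim_at_top_imp_at_infinity rm)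
  have l3: "(\<lambda>j. real (k j) * ((16 * T0 ^ 4 / s\<^sup>2 + 4) / real (m j))) \<longlonglongrightarrow> 0"
    using tendsto_mult[OF km tendsto_const[of "16 * T0 ^ 4 / s\<^sup>2 + 4"]] by (simp add: mult.commute)
  have "U \<longlonglongrightarrow> 0 + K * (2 * \<tau> T2 + 0 + 0) / \<eta> +
        16 * (2 * K\<^sup>2 * \<tau> T1 + 96 * \<eta>1 * T1 ^ 4 + 2 * K ^ 4 / \<eta>1 * (2 * \<tau> T2 + 0 + 0) + 0) / \<epsilon>\<^sup>2
        + 16 * \<eta>\<^sup>2 * s / \<epsilon>\<^sup>2"
    unfolding U_def[abs_def] using \<eta> \<eta>1 \<epsilon> by (intro tendsto_intros l1 l2 l3 kb) auto
  also have "0 + K * (2 * \<tau> T2 + 0 + 0) / \<eta> +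
        16 * (2 * K\<^sup>2 * \<tau> T1 + 96 * \<eta>1 * T1 ^ 4 + 2 * K ^ 4 / \<eta>1 * (2 * \<tau> T2 + 0 + 0) + 0) / \<epsilon>\<^sup>2
        + 16 * \<eta>\<^sup>2 * s / \<epsilon>\<^sup>2 = V"
    unfolding V_def a_def using \<eta> \<eta>1 \<epsilon> by (simp add: field_simps)
  finally have "U \<longlonglongrightarrow> V" .
  moreover have "V < \<rho>" unfolding V_def using \<eta>(1) \<eta>1(1) T1(1) T2(1) by linarith
  ultimately have "eventually (\<lambda>j. U j < \<rho>) sequentially" by (rule order_tendstoD)
  moreover have "eventually (\<lambda>j. p j \<le> U j) sequentially"
    unfolding U_def by (rule bound) (use T1 T2 \<eta>1 \<eta> in auto)
  ultimately show "eventually (\<lambda>j. p j < \<rho>) sequentially"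
    by eventually_elim auto
qed

lemma filterlim_at_top_mono_unbounded:
  fixes f :: "nat \<Rightarrow> nat"
  assumes "mono f" "\<not> bdd_above (range f)"
  shows "filterlim f at_top sequentially"
  unfolding filterlim_at_top
proof
  fix c
  obtain j where "f j > c" using assms(2) unfolding bdd_above_def by (auto simp: not_le)
  then have "f i \<ge> c" if "i \<ge> j" for i using monoD[OF assms(1) that] by simp
  then show "eventually (\<lambda>i. c \<le> f i) sequentially" unfolding eventually_sequentially by blast
qed

lemma borel_measurable_weighted_block_mean:
  assumes [measurable]: "D \<in> borel_measurable M"
    and Y: "\<And>i l. i \<in> {1..k} \<Longrightarrow> l \<in> G i \<Longrightarrow> Y l \<in> borel_measurable M"
  shows "(\<lambda>\<omega>. weighted_block_mean (D \<omega>) p k m G (\<lambda>l. Y l \<omega>)) \<in> borel_measurable M"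
proof -
  have [measurable]: "(\<lambda>\<omega>. block_mean m (G i) (\<lambda>l. Y l \<omega>)) \<in> borel_measurable M"
    "(\<lambda>\<omega>. block_sd m (G i) (\<lambda>l. Y l \<omega>)) \<in> borel_measurable M" if i: "i \<in> {1..k}" for i
  proof -
    note [measurable] = Y[OF i]
    show "(\<lambda>\<omega>. block_mean m (G i) (\<lambda>l. Y l \<omega>)) \<in> borel_measurable M"
      "(\<lambda>\<omega>. block_sd m (G i) (\<lambda>l. Y l \<omega>)) \<in> borel_measurable M"
      unfolding block_sd_def block_mean_def by measurable
  qed
  show ?thesis unfolding weighted_block_mean_def block_weight_def by measurable
qed

theorem theorem3p3:
  fixes P :: "'a measure" and X :: "'a \<Rightarrow> real" and \<mu> \<sigma> \<delta> p :: real
    and k n :: "nat \<Rightarrow> nat"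
    and M :: "nat \<Rightarrow> 'b measure" and Y :: "nat \<Rightarrow> nat \<Rightarrow> 'b \<Rightarrow> real"
    and G :: "nat \<Rightarrow> nat \<Rightarrow> nat set" and D :: "nat \<Rightarrow> 'b \<Rightarrow> real"
  assumes "prob_space P" and "X \<in> borel_measurable P"
    and "integrable P X" and "prob_space.expectation P X = \<mu>"
    and "integrable P (\<lambda>\<omega>. (X \<omega>)\<^sup>2)" and "prob_space.variance P X = \<sigma>\<^sup>2" and "\<sigma> > 0"
    and "1 \<le> \<delta>" and "\<delta> \<le> 2" and "integrable P (\<lambda>\<omega>. \<bar>X \<omega> - \<mu>\<bar> powr (1 + \<delta>))"
    and "mono k" and "\<not> bdd_above (range k)"
    and "mono n" and "\<not> bdd_above (range n)"
    and "(\<lambda>j. sqrt (real (k j * n j)) * phi P X \<mu> \<delta> (n j)) \<in> o(\<lambda>_. 1)"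
    and "\<And>j. prob_space (M j)"
    and "\<And>j. prob_space.indep_vars (M j) (\<lambda>_. borel) (Y j) {1..k j * n j}"
    and "\<And>j l. l \<in> {1..k j * n j} \<Longrightarrow> distr (M j) borel (Y j l) = distr P borel X"
    and "\<And>j. block_partition (k j) (n j) (G j)"
    and "\<And>j. D j \<in> borel_measurable (M j)"
    and "p \<ge> 1"
  shows "weak_conv_m
    (\<lambda>j. distr (M j) borel (\<lambda>\<omega>.
       sqrt (real (k j * n j)) *
       (weighted_block_mean (D j \<omega>) p (k j) (n j) (G j) (\<lambda>l. Y j l \<omega>) - \<mu>)))
    (density lborel (\<lambda>x. ennreal (normal_density 0 \<sigma> x)))"
proof -
  interpret P: prob_space P by fact
  have [measurable]: "X \<in> borel_measurable P" by fact
  \<comment> \<open>the law of a centred observation\<close>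
  define \<nu> where "\<nu> = distr P borel (\<lambda>\<omega>. X \<omega> - \<mu>)"
  have \<nu>_prob: "prob_space \<nu>" unfolding \<nu>_def by (rule P.prob_space_distr) measurable
  have \<nu>_sets [simp, measurable_cong]: "sets \<nu> = sets borel" by (simp add: \<nu>_def)
  have \<nu>_int: "(\<integral>x. f x \<partial>\<nu>) = P.expectation (\<lambda>\<omega>. f (X \<omega> - \<mu>) :: real)"
    "integrable \<nu> f \<longleftrightarrow> integrable P (\<lambda>\<omega>. f (X \<omega> - \<mu>))"
    if [measurable]: "f \<in> borel_measurable borel" for f
    unfolding \<nu>_def by (simp_all add: integral_distr integrable_distr_eq)
  have \<nu>_sq: "integrable \<nu> (\<lambda>x. x\<^sup>2)"
    using assms(3,5) by (simp add: \<nu>_int(2) power2_diff)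
  have \<nu>_mean: "(\<integral>x. x \<partial>\<nu>) = 0"
    using assms(3,4) by (simp add: \<nu>_int(1) P.prob_space)
  have \<nu>_second: "(\<integral>x. x\<^sup>2 \<partial>\<nu>) = \<sigma>\<^sup>2"
    using assms(4,6) by (simp add: \<nu>_int(1))
  have \<nu>_moment: "integrable \<nu> (\<lambda>x. \<bar>x\<bar> powr (1 + \<delta>))"
    using assms(10) by (simp add: \<nu>_int(2))
  have phi_eq: "phi P X \<mu> \<delta> m = phi \<nu> (\<lambda>x. x) 0 \<delta> m" for m
  proof -
    have "tail_moment \<nu> (\<lambda>x. x) 0 \<delta> u = tail_moment P X \<mu> \<delta> u" for u
      unfolding tail_moment_def by (subst \<nu>_int(1)) (simp_all add: indicator_def)
    then show ?thesis by (simp add: phi_def)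
  qed
  have s: "\<sigma>\<^sup>2 > 0" using assms(7) by simp
  define h where "h = weight_defect (\<sigma>\<^sup>2) p"
  have h_meas: "h \<in> borel_measurable borel" unfolding h_def by measurable
  have h_s: "h (\<sigma>\<^sup>2) = 0" unfolding h_def by (rule weight_defect_self[OF s])
  obtain K where h_lip: "\<And>u w. \<bar>h u - h w\<bar> \<le> K * min 1 \<bar>u - w\<bar>"
    using weight_defect_lipschitz[OF s, of p] assms(21) unfolding h_def by auto
  have K0: "K \<ge> 0" using order_trans[OF abs_ge_zero h_lip[of 1 0]] by simp
  define Z where "Z j l \<omega> = Y j l \<omega> - \<mu>" for j l \<omega>
  define R where "R j \<omega> = root_sum {1..k j * n j} (\<lambda>l. Z j l \<omega>)" for j \<omega>
  define W where "W j \<omega> = sqrt (real (k j * n j)) *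
       (weighted_block_mean (D j \<omega>) p (k j) (n j) (G j) (\<lambda>l. Y j l \<omega>) - \<mu>)" for j \<omega>
  have Y_meas: "Y j l \<in> borel_measurable (M j)" if "l \<in> {1..k j * n j}" for j l
    using assms(16,17)[of j] that by (auto simp: prob_space.indep_vars_def2)
  have Z_indep: "prob_space.indep_vars (M j) (\<lambda>_. borel) (Z j) {1..k j * n j}" for j
    unfolding Z_def by (rule prob_space.indep_vars_compose2[OF assms(16,17)]) measurable
  have Z_distr: "distr (M j) borel (Z j l) = \<nu>" if l: "l \<in> {1..k j * n j}" for j l
  proof -
    have "distr (M j) borel (Z j l) = distr (distr (M j) borel (Y j l)) borel (\<lambda>x. x - \<mu>)"
      using Y_meas[OF l] by (subst distr_distr) (auto simp: Z_def[abs_def] comp_def)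
    also have "\<dots> = \<nu>"
      unfolding assms(18)[OF l] \<nu>_def by (subst distr_distr) (auto simp: comp_def)
    finally show ?thesis .
  qed
  have Z_meas: "Z j l \<in> borel_measurable (M j)" if "l \<in> {1..k j * n j}" for j l
    unfolding Z_def using Y_meas[OF that] by measurable
  have R_meas: "R j \<in> borel_measurable (M j)" for j
    unfolding R_def root_sum_def using Z_meas by (intro borel_measurable_divide borel_measurable_sum) auto
  have W_meas: "W j \<in> borel_measurable (M j)" for j
    unfolding W_def
  proof (intro borel_measurable_times borel_measurable_diff borel_measurable_const
      borel_measurable_weighted_block_mean assms(20))
    fix i l assume "i \<in> {1..k j}" "l \<in> G j i"
    then have "l \<in> {1..k j * n j}" using assms(19)[of j] by (auto simp: block_partition_def)
    then show "Y j l \<in> borel_measurable (M j)" by (rule Y_meas)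
  qed
  have n_lim: "filterlim n at_top sequentially" and k_lim: "filterlim k at_top sequentially"
    using assms(11-14) by (auto intro: filterlim_at_top_mono_unbounded)
  have kn_pos: "eventually (\<lambda>j. k j > 0 \<and> n j > 0) sequentially"
    using eventually_compose_filterlim[OF eventually_gt_at_top[of 0] k_lim]
      eventually_compose_filterlim[OF eventually_gt_at_top[of 0] n_lim] by (rule eventually_conj)

  \<comment> \<open>The rate \<open>\<psi>\<close> dominates both the accumulated bias \<open>sqrt k * b\<close> and \<open>sqrt (k / n)\<close>.\<close>
  define \<psi> where "\<psi> j = sqrt (real (k j * n j)) * phi P X \<mu> \<delta> (n j)" for j
  have \<psi>: "\<psi> \<longlonglongrightarrow> 0"
    using smalloD_tendsto[OF assms(15)] by (simp add: \<psi>_def[abs_def])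

  define A where "A = (\<integral>x. \<bar>x\<bar> powr (1 + \<delta>) \<partial>\<nu>)"
  define b where "b j = K * sqrt (n j) * (\<integral>x. \<bar>x\<bar> * min 1 (x\<^sup>2 / n j) \<partial>\<nu>) + K * \<sigma>\<^sup>2 / sqrt (n j)" for j
  define C where "C = K * (1 + 2 * A) + K * \<sigma>\<^sup>2"
  have inv: "1 / sqrt (n j) \<le> sqrt (n j) * phi P X \<mu> \<delta> (n j)" if "n j > 0" for j
    by (rule inverse_sqrt_le_phi[OF assms(9) that])
  have b_nonneg: "b j \<ge> 0" for j
    unfolding b_def using K0 by (intro add_nonneg_nonneg mult_nonneg_nonneg divide_nonneg_nonneg Bochner_Integration.integral_nonneg) auto
  have b_le: "sqrt (k j) * b j \<le> C * \<psi> j" if n: "n j > 0" for j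
  proof -
    have "b j \<le> K * ((1 + 2 * A) * (sqrt (n j) * phi P X \<mu> \<delta> (n j))) + K * \<sigma>\<^sup>2 * (sqrt (n j) * phi P X \<mu> \<delta> (n j))"
      unfolding b_def
      using mult_left_mono[OF bias_integral_le_phi[OF \<nu>_sets assms(8,9) \<nu>_moment n, folded A_def phi_eq] K0]
        mult_left_mono[OF inv[OF n], of "K * \<sigma>\<^sup>2"] K0
      by (simp add: mult.assoc)
    also have "\<dots> = C * (sqrt (n j) * phi P X \<mu> \<delta> (n j))" by (simp add: C_def algebra_simps)
    finally have "sqrt (k j) * b j \<le> sqrt (k j) * (C * (sqrt (n j) * phi P X \<mu> \<delta> (n j)))"
      by (rule mult_left_mono) simp
    then show ?thesis by (simp add: \<psi>_def real_sqrt_mult mult_ac)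
  qed
  have kb: "(\<lambda>j. real (k j) * (b j)\<^sup>2) \<longlonglongrightarrow> 0"
  proof (rule tendsto_sandwich[OF _ _ tendsto_const])
    show "eventually (\<lambda>j. 0 \<le> real (k j) * (b j)\<^sup>2) sequentially" by simp
    show "eventually (\<lambda>j. real (k j) * (b j)\<^sup>2 \<le> (C * \<psi> j)\<^sup>2) sequentially"
      using kn_pos
    proof eventually_elim
      case (elim j)
      then have "(sqrt (k j) * b j)\<^sup>2 \<le> (C * \<psi> j)\<^sup>2"
        using b_le[of j] b_nonneg[of j] by (intro power_mono) auto
      then show ?case by (simp add: power_mult_distrib)
    qed
    show "(\<lambda>j. (C * \<psi> j)\<^sup>2) \<longlonglongrightarrow> 0"
      using tendsto_power[OF tendsto_mult[OF tendsto_const[of C] \<psi>], of 2] by simp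
  qed
  have kn: "(\<lambda>j. real (k j) / real (n j)) \<longlonglongrightarrow> 0"
  proof (rule tendsto_sandwich[OF _ _ tendsto_const])
    show "eventually (\<lambda>j. 0 \<le> real (k j) / real (n j)) sequentially" by simp
    show "eventually (\<lambda>j. real (k j) / real (n j) \<le> (\<psi> j)\<^sup>2) sequentially"
      using kn_pos
    proof eventually_elim
      case (elim j)
      have "sqrt (k j) * (1 / sqrt (n j)) \<le> sqrt (k j) * (sqrt (n j) * phi P X \<mu> \<delta> (n j))"
        using inv[of j] elim by (intro mult_left_mono) auto
      then have "sqrt (k j) / sqrt (n j) \<le> \<psi> j" by (simp add: \<psi>_def real_sqrt_mult mult_ac)
      then have "(sqrt (k j) / sqrt (n j))\<^sup>2 \<le> (\<psi> j)\<^sup>2" by (intro power_mono) auto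
      then show ?case by (simp add: power_divide)
    qed
    show "(\<lambda>j. (\<psi> j)\<^sup>2) \<longlonglongrightarrow> 0" using tendsto_power[OF \<psi>, of 2] by simp
  qed

  have tail: "(tail_second_moment \<nu> \<longlongrightarrow> 0) at_top" by (rule tail_second_moment_tendsto_0[OF \<nu>_sets \<nu>_sq])
  have "eventually (\<lambda>T. tail_second_moment \<nu> T < \<sigma>\<^sup>2 / 4 \<and> T \<ge> 0) at_top"
    using order_tendstoD(2)[OF tail, of "\<sigma>\<^sup>2 / 4"] s by (intro eventually_conj eventually_ge_at_top) auto
  then obtain T0 where T0: "tail_second_moment \<nu> T0 \<le> \<sigma>\<^sup>2 / 4" "T0 \<ge> 0"
    using eventually_happens[of _ "at_top :: real filter"] by (auto intro: less_imp_le)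

  have close: "(\<lambda>j. measure (M j) {\<omega> \<in> space (M j). \<bar>W j \<omega> - R j \<omega>\<bar> > \<epsilon>}) \<longlonglongrightarrow> 0" if \<epsilon>: "\<epsilon> > 0" for \<epsilon>
  proof (rule explicit_bound_vanishes[OF tail n_lim kn kb \<epsilon> measure_nonneg])
    fix T1 T2 \<eta>1 \<eta> :: real
    assume T: "T1 \<ge> 0" "T2 \<ge> 0" and \<eta>1: "\<eta>1 > 0" and \<eta>: "0 < \<eta>" "\<eta> \<le> 1 / 2"
    show "eventually (\<lambda>j. measure (M j) {\<omega> \<in> space (M j). \<bar>W j \<omega> - R j \<omega>\<bar> > \<epsilon>} \<le>
        real (k j) * ((16 * T0 ^ 4 / (\<sigma>\<^sup>2)\<^sup>2 + 4) / real (n j)) +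
        K * (2 * tail_second_moment \<nu> T2 + T2\<^sup>2 / sqrt (real (n j)) + \<sigma>\<^sup>2 / real (n j)) / \<eta> +
        16 * (2 * K\<^sup>2 * tail_second_moment \<nu> T1 + 96 * \<eta>1 * T1 ^ 4 +
          2 * K ^ 4 / \<eta>1 * (2 * tail_second_moment \<nu> T2 + T2\<^sup>2 / sqrt (real (n j)) + \<sigma>\<^sup>2 / real (n j)) +
          real (k j) * (b j)\<^sup>2) / \<epsilon>\<^sup>2 + 16 * \<eta>\<^sup>2 * \<sigma>\<^sup>2 / \<epsilon>\<^sup>2) sequentially"
      using kn_pos
    proof eventually_elim
      case (elim j)
      have arr: "block_array (M j) (Z j) (k j) (n j) (G j) \<nu> (\<sigma>\<^sup>2) h K"
        by (intro block_array.intro assms(16) block_array_axioms.intro)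
          (use elim assms(19) Z_indep Z_distr \<nu>_sq \<nu>_mean \<nu>_second s h_meas h_lip h_s in auto)
      interpret block_array "M j" "Z j" "k j" "n j" "G j" \<nu> "\<sigma>\<^sup>2" h K by (rule arr)
      have "W j \<omega> * (1 + H \<omega>) = R j \<omega> + T \<omega>"
        if "\<And>i. i \<in> {1..k j} \<Longrightarrow> \<sigma>\<^sup>2 / 4 < sample_var (G j i) (\<lambda>l. Z j l \<omega>)" for \<omega>
        using weighted_block_mean_decomposition[OF assms(19)[of j] _ _ s that[unfolded Z_def], where d="D j \<omega>" and p=p] elim
        unfolding W_def R_def H_def T_def unfolding h_def Z_def by simp
      then show ?case
        unfolding R_def b_def
        by (intro prob_far_explicit[OF T0(2) T T0(1) \<eta>1 W_meas _ \<eta> \<epsilon> order_refl]) auto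
    qed
  qed

  note N = char_normal_distribution[OF assms(7)]
  have "weak_conv_m (\<lambda>j. distr (M j) borel (W j)) (density lborel (\<lambda>x. ennreal (normal_density 0 \<sigma> x)))"
  proof (rule weak_conv_m_perturb[OF assms(16) R_meas W_meas N(1) _ close])
    fix t
    have R_char: "char (distr (M j) borel (R j)) t = char \<nu> (t / sqrt (real (k j * n j))) ^ (k j * n j)" for j
    proof -
      interpret Mj: prob_space "M j" by (rule assms(16))
      let ?N = "k j * n j"
      have "char (distr (M j) borel (R j)) t = char (distr (M j) borel (\<lambda>\<omega>. \<Sum>l\<in>{1..?N}. Z j l \<omega>)) (t / sqrt ?N)"
        using R_meas[of j] Z_meas[of _ j] unfolding R_def root_sum_def
        by (simp add: char_def integral_distr)
      also have "\<dots> = (\<Prod>l\<in>{1..?N}. char (distr (M j) borel (Z j l)) (t / sqrt ?N))"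
        by (rule Mj.char_distr_sum[OF Z_indep])
      also have "\<dots> = (\<Prod>l\<in>{1..?N}. char \<nu> (t / sqrt ?N))"
        by (rule prod.cong) (auto simp only: Z_distr)
      finally show ?thesis by simp
    qed
    have N_lim: "filterlim (\<lambda>j. k j * n j) at_top sequentially"
    proof (rule filterlim_at_top_mono[OF n_lim])
      show "eventually (\<lambda>j. n j \<le> k j * n j) sequentially" using kn_pos by eventually_elim simp
    qed
    show "(\<lambda>j. char (distr (M j) borel (R j)) t) \<longlonglongrightarrow>
        char (density lborel (\<lambda>x. ennreal (normal_density 0 \<sigma> x))) t"
      unfolding R_char N(2)
      by (rule filterlim_compose[OF char_power_tendsto[OF \<nu>_prob \<nu>_sets \<nu>_sq \<nu>_mean \<nu>_second assms(7)] N_lim])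
  qed
  then show ?thesis unfolding W_def[abs_def] .
qed

end
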